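(* Let $X$ be a triangulable, compact metric space that implies bounded degree-$k$ total persistence for some real number $k\ge1$, and let $f,g:X\to\mathbb{R}$ be two tame Lipschitz functions. Then for all real $p\ge k$, $$\Lambda_p(D(f),D(g))^p\le C\,\|f-g\|_\infty^{p-k},$$ where $$C=C_{X,k}\,\|f\|_\infty\big(\mathrm{Lip}(f)^k+\mathrm{Lip}(g)^k\big)+C_{X,k+1}\,\frac{1}{p+1}\big(\mathrm{Lip}(f)^{k+1}+\mathrm{Lip}(g)^{k+1}\big),$$ and where, for $q=k$ and $q=k+1$, $C_{X,q}$ is a constant such that $\mathrm{Pers}_q(D(h))\le C_{X,q}$ for all tame Lipschitz functions $h:X\to\mathbb{R}$ with $\mathrm{Lip}(h)\le1$.
   Context: For $f:X\to\mathbb{R}$, $M(f)$ is the persistence module with vector spaces $M(f)_a=H(f^{-1}((-\infty,a]))$, $a\in\mathbb{R}$, and maps $M(f)(a\le b)$ induced by inclusion, where $H$ is singular homology in a fixed degree with coefficients in a fixed field. Put $\beta^{a,b}=\dim\operatorname{im}M(f)(a\le b)$. $f$ is tame if for all but finitely many $a\in\mathbb{R}$, $M(f)$ is constant (all its maps are isomorphisms) and finite dimensional on some open interval containing $a$. For tame $f$, $D(f)$ denotes the persistence diagram of $M(f)$, i.e. the finite multiset of pairs (birth, death) of the intervals in its barcode, up to adjoining or removing points $(t,t)$ on the diagonal. Explicitly, if $a_1<\dots<a_N$ are the exceptional values and $s_0<a_1<s_1<\dots<a_N<s_N$, then for $i<j$ the point $(a_i,a_j)$ has multiplicity $\beta^{s_i,s_{j-1}}-\beta^{s_{i-1},s_{j-1}}-\beta^{s_i,s_j}+\beta^{s_{i-1},s_j}$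 and $(a_i,\infty)$ has multiplicity $\beta^{s_i,s_N}-\beta^{s_{i-1},s_N}$. $\mathrm{Pers}_q(D)=\sum_{(b,d)\in D}(d-b)^q$ (infinite if some $d=\infty$). $f$ is Lipschitz if $|f(x)-f(y)|\le c\,d(x,y)$ for all $x,y$ for some constant $c$; $\mathrm{Lip}(f)$ is the infimum of such $c$. $X$ implies bounded degree-$k$ total persistence if there is a constant $C_{X,k}$ with $\mathrm{Pers}_k(D(h))\le C_{X,k}$ for all tame Lipschitz $h:X\to\mathbb{R}$ with $\mathrm{Lip}(h)\le1$. $\|f\|_\infty=\sup_{x\in X}|f(x)|$. The persistence landscape of a finite diagram $D$ is $\lambda_k(t)=\lambda(k,t)=$ the $k$th largest value of $\max(\min(t-b,d-t),0)$ over $(b,d)\in D$ (and $0$ if there are fewer than $k$ points), for $k\in\{1,2,\dots\}$, $t\in\mathbb{R}$. If $\lambda,\lambda'$ are the landscapes of $D,D'$, then $\Lambda_p(D,D')=\|\lambda-\lambda'\|_p$ with $\|\lambda-\lambda'\|_p^p=\sum_{k=1}^\infty\int_{\mathbb{R}}|\lambda_k(t)-\lambda_k'(t)|^p\,dt$. Here $0^0=1$. *)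

theory Defs
  imports
    "HOL-Analysis.Analysis"
    "HOL-Homology.Homology"
    "Jordan_Normal_Form.VS_Connect"
begin

section \<open>Singular homology with coefficients in a field\<close>

text \<open>
  HOL-Homology only has integral coefficients, so the chain complex is set up again over a
  field \<open>'k\<close>, on the library's singular simplices and faces. It is unreduced.
\<close>

type_synonym ('a, 'k) field_chain = "((nat \<Rightarrow> real) \<Rightarrow> 'a) \<Rightarrow>\<^sub>0 'k"

definition field_boundary :: "nat \<Rightarrow> ('a, 'k::field) field_chain \<Rightarrow> ('a, 'k) field_chain" where
  "field_boundary n c =
     (if n = 0 then 0
      else \<Sum>\<sigma>\<in>Poly_Mapping.keys c. \<Sum>i\<le>n.
             Poly_Mapping.single (singular_face n i \<sigma>) ((-1) ^ i * Poly_Mapping.lookup c \<sigma>))"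

definition chain_space ::
    "nat \<Rightarrow> 'a topology \<Rightarrow> ('k::field, ('a, 'k) field_chain) module" where
  "chain_space n T =
     \<lparr>carrier = {c. Poly_Mapping.keys c \<subseteq> singular_simplex_set n T},
      mult = undefined, one = undefined, zero = 0, add = (+),
      smult = (\<lambda>r. Poly_Mapping.map ((*) r))\<rparr>"

definition cycle_space ::
    "nat \<Rightarrow> 'a topology \<Rightarrow> ('k::field, ('a, 'k) field_chain) module" where
  "cycle_space n T =
     (chain_space n T)\<lparr>carrier := {c \<in> carrier (chain_space n T). field_boundary n c = 0}\<rparr>"

definition boundaries :: "nat \<Rightarrow> 'a topology \<Rightarrow> ('a, 'k::field) field_chain set" where
  "boundaries n T = field_boundary (Suc n) ` carrier (chain_space (Suc n) T)"

definition quotient_space :: "('k, 'v) module \<Rightarrow> 'v set \<Rightarrow> ('k, 'v set) module" where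
  "quotient_space V W =
     \<lparr>carrier = a_rcosets\<^bsub>V\<^esub> W,
      mult = undefined, one = undefined, zero = W, add = set_add V,
      smult = (\<lambda>r A. \<Union>v\<in>A. W +>\<^bsub>V\<^esub> (r \<odot>\<^bsub>V\<^esub> v))\<rparr>"

text \<open>The map into \<open>quotient_space V W\<close> induced by a map \<open>\<phi>\<close> into \<open>V\<close>: cosets go to cosets.\<close>

definition quotient_map_to ::
    "('k, 'v) module \<Rightarrow> 'v set \<Rightarrow> ('u \<Rightarrow> 'v) \<Rightarrow> 'u set \<Rightarrow> 'v set" where
  "quotient_map_to V W \<phi> A = (\<Union>u\<in>A. W +>\<^bsub>V\<^esub> \<phi> u)"

definition field_homology ::
    "nat \<Rightarrow> 'a topology \<Rightarrow> ('k::field, ('a, 'k) field_chain set) module" where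
  "field_homology n T = quotient_space (cycle_space n T) (boundaries n T)"

section \<open>The persistence module of a function\<close>

text \<open>
  Functions on \<open>X\<close> are total functions of which only the values on \<open>X\<close> matter.
  The argument of type \<open>'k itself\<close> names the coefficient field.
\<close>

definition sublevel :: "'a::topological_space set \<Rightarrow> ('a \<Rightarrow> real) \<Rightarrow> real \<Rightarrow> 'a topology" where
  "sublevel X f a = top_of_set {x \<in> X. f x \<le> a}"

definition pers_space :: "'k::field itself \<Rightarrow> nat \<Rightarrow> 'a::topological_space set \<Rightarrow> ('a \<Rightarrow> real)
    \<Rightarrow> real \<Rightarrow> ('k, ('a, 'k) field_chain set) module" where
  "pers_space F n X f a = field_homology n (sublevel X f a)"

text \<open>
  Singular simplices are functions into the ambient type \<open>'a\<close>, so the chain map induced by the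
  inclusion of sublevel sets is the identity on chains.
\<close>

definition pers_map :: "'k::field itself \<Rightarrow> nat \<Rightarrow> 'a::topological_space set \<Rightarrow> ('a \<Rightarrow> real)
    \<Rightarrow> real \<Rightarrow> real \<Rightarrow> ('a, 'k) field_chain set \<Rightarrow> ('a, 'k) field_chain set" where
  "pers_map F n X f a b =
     quotient_map_to (cycle_space n (sublevel X f b)) (boundaries n (sublevel X f b)) (\<lambda>c. c)"

definition pers_rank :: "'k::field itself \<Rightarrow> nat \<Rightarrow> 'a::topological_space set \<Rightarrow> ('a \<Rightarrow> real)
    \<Rightarrow> real \<Rightarrow> real \<Rightarrow> nat" where
  "pers_rank F n X f a b =
     vectorspace.dim (class_ring :: 'k ring)
       ((pers_space F n X f b)
          \<lparr>carrier := pers_map F n X f a b ` carrier (pers_space F n X f a)\<rparr>)"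

definition regular_value :: "'k::field itself \<Rightarrow> nat \<Rightarrow> 'a::topological_space set
    \<Rightarrow> ('a \<Rightarrow> real) \<Rightarrow> real \<Rightarrow> bool" where
  "regular_value F n X f a \<longleftrightarrow>
     (\<exists>l u. l < a \<and> a < u \<and>
        (\<forall>s\<in>{l<..<u}. vectorspace.fin_dim (class_ring :: 'k ring) (pers_space F n X f s)) \<and>
        (\<forall>s\<in>{l<..<u}. \<forall>t\<in>{l<..<u}. s \<le> t \<longrightarrow>
           linear_map (class_ring :: 'k ring) (pers_space F n X f s) (pers_space F n X f t)
             (pers_map F n X f s t) \<and>
           bij_betw (pers_map F n X f s t)
             (carrier (pers_space F n X f s)) (carrier (pers_space F n X f t))))"

definition exceptional_values :: "'k::field itself \<Rightarrow> nat \<Rightarrow> 'a::topological_space set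
    \<Rightarrow> ('a \<Rightarrow> real) \<Rightarrow> real set" where
  "exceptional_values F n X f = {a. \<not> regular_value F n X f a}"

definition tame :: "'k::field itself \<Rightarrow> nat \<Rightarrow> 'a::topological_space set
    \<Rightarrow> ('a \<Rightarrow> real) \<Rightarrow> bool" where
  "tame F n X f \<longleftrightarrow> finite (exceptional_values F n X f)"

section \<open>Persistence diagrams\<close>

type_synonym diagram = "(real \<times> ereal) multiset"

text \<open>
  For \<open>xs = [a\<^sub>1, \<dots>, a\<^sub>N]\<close> increasing, a choice of \<open>s\<^sub>0 < a\<^sub>1 < s\<^sub>1 < \<dots> < a\<^sub>N < s\<^sub>N\<close>. For a tame
  function the multiplicities below do not depend on the choice. Note that \<open>a\<^sub>i\<close> is
  \<open>xs ! (i - 1)\<close>.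
\<close>

definition intermediate_value :: "real list \<Rightarrow> nat \<Rightarrow> real" where
  "intermediate_value xs i =
     (if i = 0 then hd xs - 1
      else if i = length xs then last xs + 1
      else (xs ! (i - 1) + xs ! i) / 2)"

text \<open>
  Among the diagrams that differ in points on the diagonal, this is the one without any such
  points. It is only meaningful for tame \<open>f\<close>, in which case the integers under \<open>nat\<close> are
  nonnegative.
\<close>

definition persistence_diagram :: "'k::field itself \<Rightarrow> nat \<Rightarrow> 'a::topological_space set
    \<Rightarrow> ('a \<Rightarrow> real) \<Rightarrow> diagram" where
  "persistence_diagram F n X f =
     (let xs = sorted_list_of_set (exceptional_values F n X f);
          N = length xs;
          a = (\<lambda>i. xs ! (i - 1));
          s = intermediate_value xs;
          \<beta> = (\<lambda>i j. int (pers_rank F n X f (s i) (s j)))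
      in (\<Sum>i\<in>{1..N}. \<Sum>j\<in>{i<..N}.
            replicate_mset (nat (\<beta> i (j - 1) - \<beta> (i - 1) (j - 1) - \<beta> i j + \<beta> (i - 1) j))
              (a i, ereal (a j)))
       + (\<Sum>i\<in>{1..N}. replicate_mset (nat (\<beta> i N - \<beta> (i - 1) N)) (a i, \<infinity>)))"

definition Pers :: "real \<Rightarrow> diagram \<Rightarrow> ereal" where
  "Pers q D =
     (\<Sum>(b, d)\<in>#D. if d = \<infinity> then \<infinity> else ereal ((real_of_ereal d - b) powr q))"

section \<open>Lipschitz functions and bounded total persistence\<close>

text \<open>\<open>c-lipschitz_on\<close> includes \<open>0 \<le> c\<close>, so \<open>Lip\<close> is \<open>0\<close> if \<open>X\<close> has at most one point.\<close>

definition Lipschitz_function :: "'a::metric_space set \<Rightarrow> ('a \<Rightarrow> real) \<Rightarrow> bool" where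
  "Lipschitz_function X f \<longleftrightarrow> (\<exists>c. c-lipschitz_on X f)"

definition Lip :: "'a::metric_space set \<Rightarrow> ('a \<Rightarrow> real) \<Rightarrow> real" where
  "Lip X f = Inf {c. c-lipschitz_on X f}"

text \<open>The supremum of \<open>\<bar>f\<bar>\<close> in \<open>[0, \<infinity>)\<close>, hence \<open>0\<close> for the empty space.\<close>

definition sup_norm :: "'a set \<Rightarrow> ('a \<Rightarrow> real) \<Rightarrow> real" where
  "sup_norm X f = (if X = {} then 0 else (SUP x\<in>X. \<bar>f x\<bar>))"

definition total_persistence_bound ::
    "'k::field itself \<Rightarrow> nat \<Rightarrow> 'a::metric_space set \<Rightarrow> real \<Rightarrow> real \<Rightarrow> bool" where
  "total_persistence_bound F n X q C \<longleftrightarrow>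
     (\<forall>h. tame F n X h \<and> Lipschitz_function X h \<and> Lip X h \<le> 1 \<longrightarrow>
        Pers q (persistence_diagram F n X h) \<le> ereal C)"

definition bounded_total_persistence ::
    "'k::field itself \<Rightarrow> nat \<Rightarrow> 'a::metric_space set \<Rightarrow> real \<Rightarrow> bool" where
  "bounded_total_persistence F n X q \<longleftrightarrow> (\<exists>C. total_persistence_bound F n X q C)"

text \<open>
  Since \<open>\<T>\<close> and its ambient Euclidean space are type and term variables of a statement,
  \<open>triangulates \<T> X\<close> as a hypothesis says that \<open>X\<close> is triangulable. Complexes in
  \<open>simplicial_complex\<close> are finite, which is the right notion for compact \<open>X\<close>.
\<close>

definition triangulates ::
    "'b::euclidean_space set set \<Rightarrow> 'a::topological_space set \<Rightarrow> bool" where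
  "triangulates \<T> X \<longleftrightarrow> simplicial_complex \<T> \<and> X homeomorphic \<Union>\<T>"

section \<open>Persistence landscapes\<close>

definition tent :: "real \<Rightarrow> real \<times> ereal \<Rightarrow> real" where
  "tent t = (\<lambda>(b, d). real_of_ereal (max (min (ereal (t - b)) (d - ereal t)) 0))"

definition landscape :: "diagram \<Rightarrow> nat \<Rightarrow> real \<Rightarrow> real" where
  "landscape D k t =
     (let vs = rev (sorted_list_of_multiset (image_mset (tent t) D))
      in if 1 \<le> k \<and> k \<le> length vs then vs ! (k - 1) else 0)"

text \<open>Powers with exponent \<open>a > 0\<close> on \<open>[0, \<infinity>]\<close>.\<close>

definition ennreal_powr :: "ennreal \<Rightarrow> real \<Rightarrow> ennreal" where
  "ennreal_powr x a = (if x = \<infinity> then \<infinity> else ennreal (enn2real x powr a))"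

definition landscape_distance :: "real \<Rightarrow> diagram \<Rightarrow> diagram \<Rightarrow> ennreal" where
  "landscape_distance p D D' =
     ennreal_powr
       (suminf (\<lambda>k. \<integral>\<^sup>+ t. ennreal (\<bar>landscape D (Suc k) t - landscape D' (Suc k) t\<bar> powr p) \<partial>lborel))
       (1 / p)"

text \<open>Real powers with \<open>0\<^sup>0 = 1\<close>; the library has \<open>0 powr 0 = 0\<close>.\<close>

definition rpow :: "real \<Rightarrow> real \<Rightarrow> real" where
  "rpow x a = (if a = 0 then 1 else x powr a)"

end

theory Submission
  imports Defs
begin

text \<open>
  No bottleneck matching is needed. Let \<open>\<epsilon> = \<parallel>f - g\<parallel>\<close>. Off the exceptional values, the number of points
  \<open>(b, d)\<close> of the diagram with \<open>b < x\<close> and \<open>d > y\<close> is the rank of \<open>M(f)(x \<le> y)\<close>, so the interleaving of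
  \<open>M(f)\<close> and \<open>M(g)\<close> by inclusions of sublevel sets gives \<open>\<bar>\<lambda>\<^sub>j - \<lambda>'\<^sub>j\<bar> \<le> \<epsilon>\<close> for all \<open>j\<close>. As landscapes are
  nonnegative, \<open>\<bar>\<lambda>\<^sub>j - \<lambda>'\<^sub>j\<bar>\<^sup>p \<le> min(\<epsilon>, \<lambda>\<^sub>j)\<^sup>p + min(\<epsilon>, \<lambda>'\<^sub>j)\<^sup>p\<close>. Summing over \<open>j\<close> and integrating turns the
  right-hand side into a sum over all points of both diagrams of integrals of truncated tents. A
  tent of height \<open>h\<close> contributes \<open>2 min(\<epsilon>, h)\<^bsup>p+1\<^esup> / (p + 1) + 2 max(h - \<epsilon>, 0) \<epsilon>\<^sup>p\<close>, and \<open>h - \<epsilon> \<le> \<parallel>f\<parallel>\<close>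
  holds for the points of both diagrams because \<open>\<parallel>g\<parallel> \<le> \<parallel>f\<parallel> + \<epsilon>\<close>. Finally
  \<open>Pers\<^sub>q(D(f)) \<le> C\<^sub>q Lip(f)\<^sup>q\<close> follows by applying the bound to \<open>f / c\<close> for \<open>c\<close> decreasing to \<open>Lip(f)\<close>.
\<close>

section \<open>Linear algebra\<close>

text \<open>Independence in the subspace is independence in the whole space, so independent subsets
  of \<open>W\<close> have at most \<open>dim\<close> elements. A maximal one therefore exists, and
  it is a basis of \<open>W\<close>.\<close>

lemma (in vectorspace) subspace_dim_le:
  assumes "fin_dim" "subspace K W V"
  shows "vectorspace.fin_dim K (vs W)" "vectorspace.dim K (vs W) \<le> dim"
proof -
  interpret W: vectorspace K "vs W" by (rule subspace_is_vs[OF assms(2)])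
  have sub: "submodule K W V" using assms(2) by (rule is_module)
  have WV: "W \<subseteq> carrier V" using sub by (simp add: submodule_def)
  have li: "finite A \<and> card A \<le> dim" if "A \<subseteq> carrier (vs W) \<and> W.lin_indpt A" for A
  proof -
    from that have "A \<subseteq> W" "lin_indpt A" using span_li_not_depend(2)[OF _ sub, of A] by auto
    then show ?thesis using li_le_dim[OF assms(1), of A] WV by auto
  qed
  have "W.lin_indpt {}" by (simp add: W.lin_dep_def)
  then obtain B where B: "finite B" "maximal B (\<lambda>S. S \<subseteq> carrier (vs W) \<and> W.lin_indpt S)"
    using maximal_exists[where P = "\<lambda>S. S \<subseteq> carrier (vs W) \<and> W.lin_indpt S" and B = "{}", OF li]
    by blast
  then have b: "W.basis B" by (intro W.max_li_is_basis)
  show "W.fin_dim" unfolding W.fin_dim_def using b B(1) by (auto simp: W.basis_def)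
  have "W.dim = card B" by (rule W.dim_basis[OF B(1) b])
  then show "W.dim \<le> dim" using li[of B] b by (auto simp: W.basis_def)
qed

lemma (in vectorspace) dim_subspace_mono:
  assumes "fin_dim" "subspace K U V" "subspace K W V" "U \<subseteq> W"
  shows "vectorspace.dim K (vs U) \<le> vectorspace.dim K (vs W)"
proof -
  interpret W: vectorspace K "vs W" by (rule subspace_is_vs[OF assms(3)])
  have "subspace K U (vs W)"
    using assms(2-4) W.vectorspace_axioms
    by (auto simp: subspace_def submodule_def vectorspace_def)
  from W.subspace_dim_le(2)[OF subspace_dim_le(1)[OF assms(1,3)] this] show ?thesis by simp
qed

lemma (in linear_map) restrict_linear_map:
  assumes "subspace K U V"
  shows "linear_map K (V.vs U) W T"
proof -
  interpret U: vectorspace K "V.vs U" by (rule V.subspace_is_vs[OF assms])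
  have "U \<subseteq> carrier V" using assms by (simp add: subspace_def submodule_def)
  then have "T \<in> module_hom K (V.vs U) W"
    using f_hom by (auto simp: module_hom_def subset_iff)
  then show ?thesis by unfold_locales
qed

text \<open>Rank-nullity for the restriction of \<open>T\<close> to \<open>U\<close>, whose kernel
  is \<open>U \<inter> kerT\<close>.\<close>

lemma (in linear_map) dim_image_add_dim_ker:
  assumes "V.fin_dim" "subspace K U V"
  shows "vectorspace.dim K (W.vs (T ` U)) + vectorspace.dim K (V.vs (U \<inter> kerT))
    = vectorspace.dim K (V.vs U)"
    and "subspace K (U \<inter> kerT) V"
proof -
  interpret R: linear_map K "V.vs U" W T by (rule restrict_linear_map[OF assms(2)])
  have UV: "U \<subseteq> carrier V" using assms(2) by (simp add: subspace_def submodule_def)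
  have ker: "R.ker = U \<inter> kerT" using UV by (auto simp: R.ker_def ker_def)
  show "vectorspace.dim K (W.vs (T ` U)) + vectorspace.dim K (V.vs (U \<inter> kerT))
    = vectorspace.dim K (V.vs U)"
    using R.rank_nullity[OF V.subspace_dim_le(1)[OF assms]] by (simp add: R.im_def ker)
  show "subspace K (U \<inter> kerT) V"
    using R.kerT_is_subspace V.vectorspace_axioms UV unfolding ker
    by (auto simp: subspace_def submodule_def vectorspace_def)
qed

lemma (in linear_map) dim_image_le:
  assumes "V.fin_dim" "subspace K U V"
  shows "vectorspace.dim K (W.vs (T ` U)) \<le> vectorspace.dim K (V.vs U)"
  using dim_image_add_dim_ker(1)[OF assms] by simp

lemma (in linear_map) dim_image_inj:
  assumes "V.fin_dim" "subspace K U V" "inj_on T (carrier V)"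
  shows "vectorspace.dim K (W.vs (T ` U)) = vectorspace.dim K (V.vs U)"
proof -
  have "\<zero>\<^bsub>V\<^esub> \<in> U" using assms(2) V.vectorspace_axioms
    by (metis subspace_def submodule.zero_closed submodule_def)
  then have "U \<inter> kerT = {\<zero>\<^bsub>V\<^esub>}"
    using inj_imp_Ker0[OF assms(3)] by (auto simp: ker_def)
  moreover have "vectorspace.dim K (V.vs kerT) = 0" by (rule inj_imp_dim_ker0[OF assms(3)])
  moreover have "kerT = {\<zero>\<^bsub>V\<^esub>}" using inj_imp_Ker0[OF assms(3)] by simp
  ultimately show ?thesis using dim_image_add_dim_ker(1)[OF assms(1,2)] by simp
qed

text \<open>The dimension that \<open>U\<close> loses under \<open>T\<close> is that of
  \<open>U \<inter> kerT\<close>, and this grows with \<open>U\<close>. The inequality is the source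
  of the nonnegative multiplicities in the diagram.\<close>

lemma (in linear_map) dim_image_supermodular:
  assumes "V.fin_dim" "subspace K U V" "subspace K U' V" "U \<subseteq> U'"
  shows "vectorspace.dim K (W.vs (T ` U')) + vectorspace.dim K (V.vs U)
    \<le> vectorspace.dim K (V.vs U') + vectorspace.dim K (W.vs (T ` U))"
  using dim_image_add_dim_ker(1)[OF assms(1,2)] dim_image_add_dim_ker(1)[OF assms(1,3)]
    V.dim_subspace_mono[OF assms(1) dim_image_add_dim_ker(2)[OF assms(1,2)]
      dim_image_add_dim_ker(2)[OF assms(1,3)]] assms(4)
  by force

lemma (in vectorspace) trivial_space:
  assumes "carrier V = {\<zero>\<^bsub>V\<^esub>}"
  shows "fin_dim" "dim = 0"
proof -
  have g: "gen_set {\<zero>\<^bsub>V\<^esub>}"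
    using span_is_subset2[of "{\<zero>\<^bsub>V\<^esub>}"] in_own_span[of "{\<zero>\<^bsub>V\<^esub>}"] assms by auto
  then show "fin_dim" unfolding fin_dim_def using assms by blast
  show "dim = 0" by (rule dim0I[OF g])
qed

section \<open>Quotient spaces and the maps induced on them\<close>

lemma (in vectorspace) subspace_abelian_subgroup:
  assumes "subspace K W V"
  shows "abelian_subgroup W V"
proof (rule abelian_subgroupI3)
  have sub: "submodule K W V" using assms by (rule is_module)
  interpret W: submodule K W V by (rule sub)
  show "additive_subgroup W V"
  proof (unfold additive_subgroup_def, rule group.subgroupI)
    show "Group.group (add_monoid V)" by (rule a_group)
    show "inv\<^bsub>add_monoid V\<^esub> v \<in> W" if "v \<in> W" for v
    proof -
      have "\<ominus>\<^bsub>V\<^esub> v = (\<ominus>\<^bsub>K\<^esub> \<one>\<^bsub>K\<^esub>) \<odot>\<^bsub>V\<^esub> v"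
        using that W.subset by (simp add: smult_minus_1 subset_iff)
      then show ?thesis using that by (simp add: a_inv_def[symmetric])
    qed
    show "W \<noteq> {}" using W.zero_closed by blast
  qed (use W.subset in auto)
  show "abelian_group V" by unfold_locales
qed

text \<open>\<open>quotient_map_to\<close> takes a union over all representatives of the coset.
  Since \<open>T\<close> maps \<open>S\<close> into \<open>R\<close>, all of them yield the same
  coset of \<open>R\<close>, and the union collapses to it.\<close>

lemma quotient_map_to_coset:
  fixes V :: "('k, 'u) module" and W :: "('k, 'v) module"
  assumes "linear_map K V W T"
    and "subspace K S V" "subspace K R W" "T ` S \<subseteq> R" "v \<in> carrier V"
  shows "quotient_map_to W R T (S +>\<^bsub>V\<^esub> v) = R +>\<^bsub>W\<^esub> T v"
proof -
  interpret linear_map K V W T by (rule assms(1))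
  interpret S: abelian_subgroup S V by (rule V.subspace_abelian_subgroup[OF assms(2)])
  interpret R: abelian_subgroup R W by (rule W.subspace_abelian_subgroup[OF assms(3)])
  have "R +>\<^bsub>W\<^esub> T y = R +>\<^bsub>W\<^esub> T v" if y: "y \<in> S +>\<^bsub>V\<^esub> v" for y
  proof -
    from y obtain s where s: "s \<in> S" "y = s \<oplus>\<^bsub>V\<^esub> v" by (auto simp: a_r_coset_def')
    then have "T y = T s \<oplus>\<^bsub>W\<^esub> T v" using assms(5) by simp
    then have "T y \<in> R +>\<^bsub>W\<^esub> T v" using s(1) assms(4) by (auto simp: a_r_coset_def')
    then show ?thesis using R.a_repr_independence' assms(5) by simp
  qed
  moreover have "v \<in> S +>\<^bsub>V\<^esub> v" by (rule S.a_rcos_self[OF assms(5)])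
  ultimately show ?thesis unfolding quotient_map_to_def by blast
qed

lemma (in vectorspace) smult_linear_map:
  assumes "r \<in> carrier K"
  shows "linear_map K V V (\<lambda>v. r \<odot>\<^bsub>V\<^esub> v)"
proof -
  have "(\<lambda>v. r \<odot>\<^bsub>V\<^esub> v) \<in> module_hom K V V"
    using assms by (auto simp: module_hom_def smult_r_distr smult_assoc1[symmetric] m_comm)
  then show ?thesis by unfold_locales
qed

text \<open>Scalar multiplication in \<open>quotient_space\<close> has the form of the map induced
  by v \<mapsto> r v, so it is an instance of \<open>quotient_map_to_coset\<close>.\<close>

lemma quotient_smult_coset:
  fixes V :: "('k, 'v) module"
  assumes "vectorspace K V" "subspace K W V" "r \<in> carrier K" "v \<in> carrier V"
  shows "r \<odot>\<^bsub>quotient_space V W\<^esub> (W +>\<^bsub>V\<^esub> v) = W +>\<^bsub>V\<^esub> (r \<odot>\<^bsub>V\<^esub> v)"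
proof -
  interpret vectorspace K V by (rule assms(1))
  have "(\<lambda>v. r \<odot>\<^bsub>V\<^esub> v) ` W \<subseteq> W"
    using assms(2,3) by (auto simp: subspace_def submodule_def)
  from quotient_map_to_coset[OF smult_linear_map[OF assms(3)] assms(2,2) this assms(4)] show ?thesis
    by (simp add: quotient_space_def quotient_map_to_def)
qed

lemma carrier_quotient_space: "carrier (quotient_space V W) = (\<lambda>v. W +>\<^bsub>V\<^esub> v) ` carrier V"
  by (auto simp: quotient_space_def A_RCOSETS_def')

lemma quotient_add_coset:
  fixes V :: "('k, 'v) module"
  assumes "vectorspace K V" "subspace K W V" "u \<in> carrier V" "v \<in> carrier V"
  shows "(W +>\<^bsub>V\<^esub> u) \<oplus>\<^bsub>quotient_space V W\<^esub> (W +>\<^bsub>V\<^esub> v) = W +>\<^bsub>V\<^esub> (u \<oplus>\<^bsub>V\<^esub> v)"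
  using abelian_subgroup.a_rcos_sum[OF vectorspace.subspace_abelian_subgroup[OF assms(1,2)] assms(3,4)]
  by (simp add: quotient_space_def)

lemma quotient_vectorspace:
  fixes V :: "('k, 'v) module"
  assumes V: "vectorspace K V" and W: "subspace K W V"
  shows "vectorspace K (quotient_space V W)"
proof -
  let ?Q = "quotient_space V W"
  interpret vectorspace K V by (rule V)
  interpret W: abelian_subgroup W V by (rule subspace_abelian_subgroup[OF W])
  \<comment> \<open>The zero of \<open>quotient_space\<close> is \<open>W\<close> itself. Once it is
    written as the coset of zero, all the axioms can be checked on representatives.\<close>
  have "W +>\<^bsub>V\<^esub> \<zero>\<^bsub>V\<^esub> = W" using W.a_rcos_const[of "\<zero>\<^bsub>V\<^esub>"] by simp
  then have zero: "\<zero>\<^bsub>?Q\<^esub> = W +>\<^bsub>V\<^esub> \<zero>\<^bsub>V\<^esub>" by (simp add: quotient_space_def)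
  note Q = carrier_quotient_space[of V W] zero quotient_add_coset[OF V W] quotient_smult_coset[OF V W]
  have ex: "\<exists>w\<in>carrier ?Q. (W +>\<^bsub>V\<^esub> v) \<oplus>\<^bsub>?Q\<^esub> w = \<zero>\<^bsub>?Q\<^esub>" if "v \<in> carrier V" for v
    using that by (intro bexI[of _ "W +>\<^bsub>V\<^esub> (\<ominus>\<^bsub>V\<^esub> v)"]) (auto simp: Q M.r_neg)
  show ?thesis
  proof (rule vs_criteria)
    show "field K" by unfold_locales
    show "\<forall>v\<in>carrier ?Q. \<exists>w\<in>carrier ?Q. v \<oplus>\<^bsub>?Q\<^esub> w = \<zero>\<^bsub>?Q\<^esub>"
      using ex by (auto simp: Q(1))
  qed (auto simp: Q M.a_ac smult_assoc1 smult_l_distr smult_r_distr)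
qed

lemma quotient_linear_map:
  fixes V :: "('k, 'u) module" and W :: "('k, 'v) module"
  assumes "linear_map K V W T" and "subspace K S V" "subspace K R W" "T ` S \<subseteq> R"
  shows "linear_map K (quotient_space V S) (quotient_space W R) (quotient_map_to W R T)"
proof -
  interpret linear_map K V W T by (rule assms(1))
  note c = quotient_map_to_coset[OF assms] quotient_add_coset[OF V.vectorspace_axioms assms(2)]
    quotient_add_coset[OF W.vectorspace_axioms assms(3)]
    quotient_smult_coset[OF V.vectorspace_axioms assms(2)]
    quotient_smult_coset[OF W.vectorspace_axioms assms(3)]
  have "quotient_map_to W R T \<in> module_hom K (quotient_space V S) (quotient_space W R)"
    unfolding module_hom_def
    by (auto simp: carrier_quotient_space c)
  with quotient_vectorspace[OF V.vectorspace_axioms assms(2)]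
    quotient_vectorspace[OF W.vectorspace_axioms assms(3)]
  show ?thesis unfolding linear_map_def mod_hom_def mod_hom_axioms_def vectorspace_def by auto
qed

section \<open>Homology over a field\<close>

lemma lookup_map_mult [simp]:
  "Poly_Mapping.lookup (Poly_Mapping.map ((*) (r::'k::field)) c) x = r * Poly_Mapping.lookup c x"
  by transfer (simp add: when_def)

lemma map_mult_keys: "Poly_Mapping.keys (Poly_Mapping.map ((*) (r::'k::field)) c) \<subseteq> Poly_Mapping.keys c"
  by (auto simp: in_keys_iff)

lemma map_mult_0 [simp]: "Poly_Mapping.map ((*) (r::'k::field)) 0 = 0"
  by (rule poly_mapping_eqI) simp

lemma map_mult_single: "Poly_Mapping.map ((*) (r::'k::field)) (Poly_Mapping.single x a)
    = Poly_Mapping.single x (r * a)"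
  by (rule poly_mapping_eqI) (simp add: lookup_single when_def)

lemma map_mult_sum: "Poly_Mapping.map ((*) (r::'k::field)) (sum h I)
    = (\<Sum>i\<in>I. Poly_Mapping.map ((*) r) (h i))"
  by (rule poly_mapping_eqI) (simp add: lookup_sum sum_distrib_left)

lemma sum_keys_superset:
  assumes "finite S" "Poly_Mapping.keys c \<subseteq> S" "\<And>x. G x 0 = 0"
  shows "(\<Sum>x\<in>Poly_Mapping.keys c. G x (Poly_Mapping.lookup c x)) = (\<Sum>x\<in>S. G x (Poly_Mapping.lookup c x))"
  by (rule sum.mono_neutral_left) (use assms in \<open>auto simp: in_keys_iff\<close>)

lemma poly_mapping_sum_single:
  "c = (\<Sum>x\<in>Poly_Mapping.keys c. Poly_Mapping.single x (Poly_Mapping.lookup c x))"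
  by (rule poly_mapping_eqI)
    (simp add: lookup_sum lookup_single when_def sum.delta in_keys_iff)

context
  fixes n :: nat
begin

text \<open>The contribution of one simplex with coefficient \<open>a\<close>. It vanishes at
  \<open>a = 0\<close>, so the boundary may be summed over any finite superset of the support;
  linearity in \<open>a\<close> then gives linearity of the boundary, although the supports of two
  chains and of their sum differ.\<close>

private definition G :: "((nat \<Rightarrow> real) \<Rightarrow> 'a) \<Rightarrow> 'k::field \<Rightarrow> ('a, 'k) field_chain" where
  "G \<sigma> a = (if n = 0 then 0 else \<Sum>i\<le>n. Poly_Mapping.single (singular_face n i \<sigma>) ((-1) ^ i * a))"

private lemma boundary_G:
  assumes "finite S" "Poly_Mapping.keys c \<subseteq> S"
  shows "field_boundary n c = (\<Sum>\<sigma>\<in>S. G \<sigma> (Poly_Mapping.lookup c \<sigma>))"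
proof -
  have "G \<sigma> 0 = 0" for \<sigma> :: "(nat \<Rightarrow> real) \<Rightarrow> 'a" by (simp add: G_def)
  from sum_keys_superset[OF assms, of G, OF this] show ?thesis
    unfolding field_boundary_def G_def by (cases "n = 0") simp_all
qed

lemma field_boundary_single:
  "field_boundary n (Poly_Mapping.single \<sigma> a)
    = (if n = 0 then 0 else \<Sum>i\<le>n. Poly_Mapping.single (singular_face n i \<sigma>) ((-1) ^ i * a))"
  using boundary_G[of "{\<sigma>}" "Poly_Mapping.single \<sigma> a"] by (simp add: G_def lookup_single)

lemma field_boundary_add: "field_boundary n (c + d) = field_boundary n c + field_boundary n d"
proof -
  let ?S = "Poly_Mapping.keys c \<union> Poly_Mapping.keys d"
  have "G \<sigma> (a + b) = G \<sigma> a + G \<sigma> b" for \<sigma> :: "(nat \<Rightarrow> real) \<Rightarrow> 'a" and a b :: 'b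
    by (simp add: G_def distrib_left single_add sum.distrib)
  then show ?thesis
    using boundary_G[of ?S "c + d"] boundary_G[of ?S c] boundary_G[of ?S d] keys_add[of c d]
    by (simp add: lookup_add sum.distrib)
qed

lemma field_boundary_smult:
  "field_boundary n (Poly_Mapping.map ((*) r) c) = Poly_Mapping.map ((*) r) (field_boundary n c)"
proof -
  let ?S = "Poly_Mapping.keys c"
  have "G \<sigma> (r * a) = Poly_Mapping.map ((*) r) (G \<sigma> a)" for \<sigma> :: "(nat \<Rightarrow> real) \<Rightarrow> 'a" and a
    by (simp add: G_def map_mult_sum map_mult_single mult_ac)
  moreover have "Poly_Mapping.keys (Poly_Mapping.map ((*) r) c) \<subseteq> ?S"
    by (auto simp: in_keys_iff)
  ultimately show ?thesis
    using boundary_G[of ?S "Poly_Mapping.map ((*) r) c"] boundary_G[of ?S c]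
    by (simp add: map_mult_sum)
qed

lemma field_boundary_0 [simp]: "field_boundary n 0 = 0"
  by (simp add: field_boundary_def)

lemma field_boundary_diff: "field_boundary n (c - d) = field_boundary n c - field_boundary n d"
  using field_boundary_add[of "c - d" d] by simp

lemma field_boundary_sum: "field_boundary n (sum h I) = (\<Sum>i\<in>I. field_boundary n (h i))"
  by (induction I rule: infinite_finite_induct) (simp_all add: field_boundary_add)

end

text \<open>
  A homomorphism \<open>\<int> \<rightarrow> 'k\<close> of coefficient groups commutes with the boundary, so the vanishing of
  the square of the boundary follows from the integral case.
\<close>

definition coeff_map :: "'k::field \<Rightarrow> ('b \<Rightarrow>\<^sub>0 int) \<Rightarrow> ('b \<Rightarrow>\<^sub>0 'k)" where
  "coeff_map a = Poly_Mapping.map (\<lambda>m. of_int m * a)"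

lemma lookup_coeff_map [simp]:
  "Poly_Mapping.lookup (coeff_map a c) x = of_int (Poly_Mapping.lookup c x) * a"
  unfolding coeff_map_def by transfer (simp add: when_def)

lemma coeff_map_diff: "coeff_map a (c - d) = coeff_map a c - coeff_map a d"
  by (rule poly_mapping_eqI) (simp add: lookup_minus algebra_simps)

lemma coeff_map_sum: "coeff_map a (sum h I) = (\<Sum>i\<in>I. coeff_map a (h i))"
  by (rule poly_mapping_eqI) (simp add: lookup_sum sum_distrib_right)

lemma coeff_map_single: "coeff_map a (Poly_Mapping.single x m) = Poly_Mapping.single x (of_int m * a)"
  by (rule poly_mapping_eqI) (simp add: lookup_single when_def)

lemma coeff_map_cmul_frag_of: "coeff_map a (frag_cmul m (frag_of x)) = Poly_Mapping.single x (of_int m * a)"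
  by (rule poly_mapping_eqI) (simp add: lookup_single when_def)

lemma coeff_map_0 [simp]: "coeff_map a 0 = 0"
  by (rule poly_mapping_eqI) simp

lemma field_boundary_coeff_map:
  "field_boundary n (coeff_map a c) = coeff_map a (chain_boundary n c)"
proof (rule frag_induction[of c UNIV])
  show "field_boundary n (coeff_map a (frag_of \<sigma>)) = coeff_map a (chain_boundary n (frag_of \<sigma>))" for \<sigma>
    by (simp add: coeff_map_single field_boundary_single chain_boundary_of coeff_map_sum coeff_map_cmul_frag_of)
qed (auto simp: coeff_map_diff field_boundary_diff chain_boundary_diff)

lemma carrier_chain_space:
  "c \<in> carrier (chain_space n T) \<longleftrightarrow> Poly_Mapping.keys c \<subseteq> singular_simplex_set n T"
  by (simp add: chain_space_def)

lemma field_boundary_boundary: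
  assumes "c \<in> carrier (chain_space (Suc n) T)"
  shows "field_boundary n (field_boundary (Suc n) c) = 0"
proof -
  have "field_boundary n (field_boundary (Suc n) (Poly_Mapping.single \<sigma> a)) = 0"
    if "singular_simplex (Suc n) T \<sigma>" for \<sigma> a
  proof -
    \<comment> \<open>Every multiple of a simplex is the image of the integral generator under the
      coefficient map 1 \<mapsto> a.\<close>
    have "Poly_Mapping.single \<sigma> a = coeff_map a (frag_of \<sigma>)" by (simp add: coeff_map_single)
    moreover have "chain_boundary n (chain_boundary (Suc n) (frag_of \<sigma>)) = 0"
      using that by (intro chain_boundary_boundary_alt[of _ T]) (simp add: singular_chain_of)
    ultimately show ?thesis by (simp add: field_boundary_coeff_map)
  qed
  with assms show ?thesis
    by (subst poly_mapping_sum_single[of c])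
      (auto simp: field_boundary_sum carrier_chain_space intro!: sum.neutral)
qed

lemma field_boundary_in_chain_space:
  assumes "c \<in> carrier (chain_space (Suc n) T)"
  shows "field_boundary (Suc n) c \<in> carrier (chain_space n T)"
proof -
  have "Poly_Mapping.keys (field_boundary (Suc n) c)
    \<subseteq> (\<Union>\<sigma>\<in>Poly_Mapping.keys c. \<Union>i\<le>Suc n. {singular_face (Suc n) i \<sigma>})"
    unfolding field_boundary_def
    by (fastforce simp del: sum.atMost_Suc dest!: subsetD[OF keys_sum] split: if_splits)
  moreover have "singular_simplex n T (singular_face (Suc n) i \<sigma>)"
    if "\<sigma> \<in> Poly_Mapping.keys c" "i \<le> Suc n" for i \<sigma>
    using singular_simplex_singular_face[of "Suc n" T \<sigma> i] that assms
    by (auto simp: carrier_chain_space)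
  ultimately show ?thesis by (auto simp: carrier_chain_space)
qed

lemma vectorspace_chains:
  fixes C :: "('b \<Rightarrow>\<^sub>0 'k::field) set"
  assumes "0 \<in> C" "\<And>c d. c \<in> C \<Longrightarrow> d \<in> C \<Longrightarrow> c + d \<in> C"
    "\<And>r c. c \<in> C \<Longrightarrow> Poly_Mapping.map ((*) r) c \<in> C"
  shows "vectorspace (class_ring :: 'k ring) \<lparr>carrier = C, mult = x, one = y, zero = 0, add = (+),
      smult = (\<lambda>r. Poly_Mapping.map ((*) r))\<rparr>" (is "vectorspace _ ?V")
proof (rule vs_criteria)
  show "field (class_ring :: 'k ring)" by (rule class_field.field_axioms)
  have "\<exists>d\<in>C. c + d = 0" if "c \<in> C" for c
    using assms(3)[OF that, of "-1"]
    by (rule bexI[rotated]) (rule poly_mapping_eqI, simp add: lookup_add)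
  then show "\<forall>v\<in>carrier ?V. \<exists>w\<in>carrier ?V. v \<oplus>\<^bsub>?V\<^esub> w = \<zero>\<^bsub>?V\<^esub>"
    by simp
qed (auto simp: assms intro!: poly_mapping_eqI simp: lookup_add algebra_simps)

lemma cycle_space_vectorspace:
  "vectorspace class_ring (cycle_space n T :: ('k::field, ('a, 'k) field_chain) module)"
proof -
  let ?C = "{c :: ('a, 'k) field_chain \<in> {c. Poly_Mapping.keys c \<subseteq> singular_simplex_set n T}. field_boundary n c = 0}"
  have "c + d \<in> ?C" if "c \<in> ?C" "d \<in> ?C" for c d
    using that keys_add[of c d] by (auto simp: field_boundary_add)
  moreover have "Poly_Mapping.map ((*) r) c \<in> ?C" if "c \<in> ?C" for r c
    using that map_mult_keys[of r c] by (auto simp: field_boundary_smult)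
  ultimately show ?thesis
    unfolding cycle_space_def chain_space_def
    using vectorspace_chains[of ?C undefined undefined] by simp
qed

lemma boundaries_subspace: "subspace class_ring (boundaries n T) (cycle_space n T)"
proof -
  let ?B = "boundaries n T" and ?Z = "cycle_space n T"
  have "?B \<subseteq> carrier ?Z"
    using field_boundary_in_chain_space[of _ n T] field_boundary_boundary[of _ n T]
    by (auto simp: boundaries_def cycle_space_def)
  moreover have "c + d \<in> ?B" if "c \<in> ?B" "d \<in> ?B" for c d
  proof -
    from that obtain c' d' where cd: "c = field_boundary (Suc n) c'" "d = field_boundary (Suc n) d'"
      "c' \<in> carrier (chain_space (Suc n) T)" "d' \<in> carrier (chain_space (Suc n) T)"
      by (auto simp: boundaries_def)
    then have "c' + d' \<in> carrier (chain_space (Suc n) T)"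
      using keys_add[of c' d'] by (auto simp: carrier_chain_space)
    then show ?thesis unfolding boundaries_def cd field_boundary_add[symmetric] by (rule imageI)
  qed
  moreover have "Poly_Mapping.map ((*) r) c \<in> ?B" if "c \<in> ?B" for r c
  proof -
    from that obtain c' where c: "c = field_boundary (Suc n) c'" "c' \<in> carrier (chain_space (Suc n) T)"
      by (auto simp: boundaries_def)
    then have "Poly_Mapping.map ((*) r) c' \<in> carrier (chain_space (Suc n) T)"
      using map_mult_keys[of r c'] by (auto simp: carrier_chain_space)
    then show ?thesis unfolding boundaries_def c field_boundary_smult[symmetric] by (rule imageI)
  qed
  moreover have "0 \<in> ?B"
    unfolding boundaries_def by (rule image_eqI[of _ _ 0]) (simp_all add: carrier_chain_space)
  ultimately show ?thesis
    using cycle_space_vectorspace[of n T]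
    by (auto simp: subspace_def submodule_def vectorspace_def) (auto simp: cycle_space_def chain_space_def)
qed


section \<open>Ranks of inclusions in homology\<close>

text \<open>Homology is indexed by arbitrary subsets rather than by sublevels of one function, so
  that sublevel sets of two different functions can be compared by inclusion.\<close>

definition hspace :: "'k::field itself \<Rightarrow> nat \<Rightarrow> 'a::topological_space set
    \<Rightarrow> ('k, ('a, 'k) field_chain set) module" where
  "hspace F n A = field_homology n (top_of_set A)"

text \<open>Only the target is an argument: enlarging a coset to a coset of the boundaries of
  \<open>B\<close> is the same formula for every source contained in \<open>B\<close>.\<close>

definition hmap :: "nat \<Rightarrow> 'a::topological_space set \<Rightarrow> ('a, 'k::field) field_chain set \<Rightarrow> ('a, 'k) field_chain set" where
  "hmap n B = quotient_map_to (cycle_space n (top_of_set B)) (boundaries n (top_of_set B)) (\<lambda>c. c)"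

definition hrank :: "'k::field itself \<Rightarrow> nat \<Rightarrow> 'a::topological_space set \<Rightarrow> 'a set \<Rightarrow> nat" where
  "hrank F n A B = vectorspace.dim (class_ring :: 'k ring)
    ((hspace F n B)\<lparr>carrier := hmap n B ` carrier (hspace F n A)\<rparr>)"

abbreviation hfin :: "'k::field itself \<Rightarrow> nat \<Rightarrow> 'a::topological_space set \<Rightarrow> bool" where
  "hfin F n A \<equiv> vectorspace.fin_dim (class_ring :: 'k ring) (hspace F n A)"

lemma hspace_vectorspace: "vectorspace class_ring (hspace F n A)"
  unfolding hspace_def field_homology_def
  by (rule quotient_vectorspace[OF cycle_space_vectorspace boundaries_subspace])

context
  fixes A B :: "'a::topological_space set"
  assumes AB: "A \<subseteq> B"
begin

lemma chain_space_mono: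
  "carrier (chain_space m (top_of_set A)) \<subseteq> carrier (chain_space m (top_of_set B))"
  using singular_simplex_mono[OF _ AB, of m euclidean]
  unfolding subset_iff carrier_chain_space mem_Collect_eq by blast

lemma cycle_space_mono:
  "carrier (cycle_space m (top_of_set A)) \<subseteq> carrier (cycle_space m (top_of_set B))"
  using chain_space_mono by (auto simp: cycle_space_def)

lemma inclusion_linear:
  "linear_map class_ring (cycle_space n (top_of_set A) :: ('k::field, ('a, 'k) field_chain) module)
    (cycle_space n (top_of_set B)) (\<lambda>c. c)"
proof -
  have "(\<lambda>c. c) \<in> module_hom class_ring (cycle_space n (top_of_set A) :: ('k::field, ('a, 'k) field_chain) module)
    (cycle_space n (top_of_set B))"
    using cycle_space_mono by (auto simp: module_hom_def cycle_space_def chain_space_def)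
  moreover have "vectorspace class_ring (cycle_space n (top_of_set A) :: ('k, ('a, 'k) field_chain) module)"
    "vectorspace class_ring (cycle_space n (top_of_set B) :: ('k, ('a, 'k) field_chain) module)"
    by (rule cycle_space_vectorspace)+
  ultimately show ?thesis unfolding linear_map_def mod_hom_def mod_hom_axioms_def vectorspace_def by auto
qed

lemma boundaries_mono: "(\<lambda>c. c) ` boundaries n (top_of_set A) \<subseteq> boundaries n (top_of_set B)"
  using chain_space_mono by (auto simp: boundaries_def)

lemma hmap_linear: "linear_map class_ring (hspace F n A) (hspace F n B) (hmap n B)"
  unfolding hspace_def field_homology_def hmap_def
  by (rule quotient_linear_map[OF inclusion_linear boundaries_subspace boundaries_subspace boundaries_mono])

lemma hmap_coset:
  assumes "z \<in> carrier (cycle_space n (top_of_set A))"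
  shows "hmap n B (boundaries n (top_of_set A) +>\<^bsub>cycle_space n (top_of_set A)\<^esub> z)
    = boundaries n (top_of_set B) +>\<^bsub>cycle_space n (top_of_set B)\<^esub> z"
  unfolding hmap_def
  by (rule quotient_map_to_coset[OF inclusion_linear boundaries_subspace boundaries_subspace boundaries_mono assms])

end

lemma carrier_hspace: "carrier (hspace F n A) =
  (\<lambda>z. boundaries n (top_of_set A) +>\<^bsub>cycle_space n (top_of_set A)\<^esub> z) ` carrier (cycle_space n (top_of_set A))"
  by (simp add: hspace_def field_homology_def carrier_quotient_space)

lemma hmap_id: "x \<in> carrier (hspace F n A) \<Longrightarrow> hmap n A x = x"
  by (auto simp: carrier_hspace hmap_coset)

lemma hmap_hmap:
  assumes "A \<subseteq> B" "B \<subseteq> C" "x \<in> carrier (hspace F n A)"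
  shows "hmap n C (hmap n B x) = hmap n C x"
proof -
  from assms(3) obtain z where z: "z \<in> carrier (cycle_space n (top_of_set A))"
    and x: "x = boundaries n (top_of_set A) +>\<^bsub>cycle_space n (top_of_set A)\<^esub> z"
    by (auto simp: carrier_hspace)
  have "z \<in> carrier (cycle_space n (top_of_set B))" using z cycle_space_mono[OF assms(1)] by blast
  moreover have "A \<subseteq> C" using assms by blast
  ultimately show ?thesis
    unfolding x using z by (simp add: hmap_coset[OF assms(1)] hmap_coset[OF assms(2)] hmap_coset[of A C])
qed

lemma hmap_image_subspace:
  assumes "A \<subseteq> B"
  shows "subspace class_ring (hmap n B ` carrier (hspace F n A)) (hspace F n B)"
  using linear_map.imT_is_subspace[OF hmap_linear[OF assms]]
  unfolding mod_hom.im_def[OF linear_map.axioms(3)[OF hmap_linear[OF assms]]] .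

lemma hmap_image_image:
  assumes "A \<subseteq> B" "B \<subseteq> C"
  shows "hmap n C ` carrier (hspace F n A) = hmap n C ` hmap n B ` carrier (hspace F n A)"
  unfolding image_image by (rule image_cong) (simp_all add: hmap_hmap[OF assms])

lemma hmap_closed: "A \<subseteq> B \<Longrightarrow> hmap n B ` carrier (hspace F n A) \<subseteq> carrier (hspace F n B)"
  using linear_map.T_im[OF hmap_linear] by blast

text \<open>The images of the homology of \<open>A\<close> and \<open>B\<close> in that of
  \<open>C\<close> are nested, and the larger one loses at least as much dimension on the way to
  \<open>D\<close>.\<close>

lemma hrank_supermodular:
  assumes "A \<subseteq> B" "B \<subseteq> C" "C \<subseteq> D" "hfin F n C"
  shows "hrank F n A C + hrank F n B D \<le> hrank F n B C + hrank F n A D"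
proof -
  interpret L: linear_map class_ring "hspace F n C" "hspace F n D" "hmap n D" by (rule hmap_linear) fact
  have AC: "A \<subseteq> C" using assms by blast
  have "hmap n C ` carrier (hspace F n A) \<subseteq> hmap n C ` carrier (hspace F n B)"
    unfolding hmap_image_image[OF assms(1,2)] by (rule image_mono[OF hmap_closed[OF assms(1)]])
  from L.dim_image_supermodular[OF assms(4) hmap_image_subspace[OF AC] hmap_image_subspace[OF assms(2)] this]
  show ?thesis
    by (simp add: hrank_def hmap_image_image[OF AC assms(3)] hmap_image_image[OF assms(2,3)])
qed

text \<open>The map from \<open>A\<close> to \<open>D\<close> factors through the map from
  \<open>B\<close> to \<open>C\<close>. With sublevel sets of one function outside and of another
  inside, this becomes the interleaving inequality.\<close>

lemma hrank_mono:
  assumes "A \<subseteq> B" "B \<subseteq> C" "C \<subseteq> D" "hfin F n C"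
  shows "hrank F n A D \<le> hrank F n B C"
proof -
  interpret L: linear_map class_ring "hspace F n C" "hspace F n D" "hmap n D" by (rule hmap_linear) fact
  have AC: "A \<subseteq> C" using assms by blast
  have "hmap n C ` carrier (hspace F n A) \<subseteq> hmap n C ` carrier (hspace F n B)"
    unfolding hmap_image_image[OF assms(1,2)] by (rule image_mono[OF hmap_closed[OF assms(1)]])
  from L.V.dim_subspace_mono[OF assms(4) hmap_image_subspace[OF AC] hmap_image_subspace[OF assms(2)] this]
    L.dim_image_le[OF assms(4) hmap_image_subspace[OF AC]]
  show ?thesis
    by (simp add: hrank_def hmap_image_image[OF AC assms(3)])
qed

text \<open>Together with \<open>hrank_inj\<close>: an isomorphism at either end leaves the rank
  unchanged, so ranks of a tame function are constant between exceptional values.\<close>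

lemma hrank_surj:
  assumes "A \<subseteq> B" "B \<subseteq> C" "hmap n B ` carrier (hspace F n A) = carrier (hspace F n B)"
  shows "hrank F n A C = hrank F n B C"
  unfolding hrank_def hmap_image_image[OF assms(1,2)] assms(3) ..

lemma hrank_inj:
  assumes "A \<subseteq> B" "B \<subseteq> C" "inj_on (hmap n C) (carrier (hspace F n B))" "hfin F n B"
  shows "hrank F n A C = hrank F n A B"
proof -
  interpret L: linear_map class_ring "hspace F n B" "hspace F n C" "hmap n C" by (rule hmap_linear) fact
  show ?thesis unfolding hrank_def hmap_image_image[OF assms(1,2)]
    by (rule L.dim_image_inj[OF assms(4) hmap_image_subspace[OF assms(1)] assms(3)])
qed

text \<open>There are no singular simplices in the empty space, hence 0 is the only cycle. This is
  the situation below the lower bound of a function.\<close>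

lemma hspace_empty:
  fixes F :: "'k::field itself"
  shows "hfin F n ({} :: 'a::topological_space set)"
    and "hrank F n ({} :: 'a set) B = 0"
proof -
  interpret V: vectorspace class_ring "hspace F n ({} :: 'a set)" by (rule hspace_vectorspace)
  have "singular_simplex_set n (trivial_topology :: 'a topology) = {}"
    by (simp add: singular_simplex_empty)
  then have "Poly_Mapping.keys x \<subseteq> singular_simplex_set n (trivial_topology :: 'a topology) \<longleftrightarrow> x = 0"
    for x :: "('a, 'k) field_chain"
    by (simp only: subset_empty keys_eq_empty)
  then have "carrier (cycle_space n (top_of_set ({} :: 'a set)) :: ('k, ('a, 'k) field_chain) module) = {0}"
    by (auto simp: cycle_space_def chain_space_def)
  then have "is_singleton (carrier (hspace F n ({} :: 'a set)))" by (simp add: carrier_hspace)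
  then have c: "carrier (hspace F n ({} :: 'a set)) = {\<zero>\<^bsub>hspace F n {}\<^esub>}"
    using V.zero_closed by (auto simp: is_singleton_def)
  then show "hfin F n ({} :: 'a set)" by (rule V.trivial_space)
  interpret L: linear_map class_ring "hspace F n ({} :: 'a set)" "hspace F n B" "hmap n B"
    by (rule hmap_linear) simp
  have im: "hmap n B ` carrier (hspace F n {}) = {\<zero>\<^bsub>hspace F n B\<^esub>}" using c by simp
  have "vectorspace class_ring ((hspace F n B)\<lparr>carrier := hmap n B ` carrier (hspace F n {})\<rparr>)"
    by (rule L.W.subspace_is_vs[OF hmap_image_subspace]) simp
  from vectorspace.trivial_space(2)[OF this] show "hrank F n ({} :: 'a set) B = 0"
    by (simp add: hrank_def im)
qed

section \<open>Diagrams of rank functions\<close>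

text \<open>The formula of \<open>persistence_diagram\<close> for an abstract function
  \<open>r\<close> in place of the ranks, so that points can be counted without mentioning
  homology.\<close>

definition rank_diagram :: "(real \<Rightarrow> real \<Rightarrow> nat) \<Rightarrow> real set \<Rightarrow> diagram" where
  "rank_diagram r E =
     (let xs = sorted_list_of_set E;
          N = length xs;
          a = (\<lambda>i. xs ! (i - 1));
          s = intermediate_value xs;
          \<beta> = (\<lambda>i j. int (r (s i) (s j)))
      in (\<Sum>i\<in>{1..N}. \<Sum>j\<in>{i<..N}.
            replicate_mset (nat (\<beta> i (j - 1) - \<beta> (i - 1) (j - 1) - \<beta> i j + \<beta> (i - 1) j))
              (a i, ereal (a j)))
       + (\<Sum>i\<in>{1..N}. replicate_mset (nat (\<beta> i N - \<beta> (i - 1) N)) (a i, \<infinity>)))"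

text \<open>Numbers the gaps between exceptional values, with the two unbounded gaps
  \<open>k = 0\<close> and \<open>k = length xs\<close> treated like the others. Ranks depend on the
  gaps alone, by \<open>rank_cuts\<close>.\<close>

definition cuts :: "real list \<Rightarrow> nat \<Rightarrow> real \<Rightarrow> bool" where
  "cuts xs k x \<longleftrightarrow> k \<le> length xs \<and> (\<forall>m<length xs. if m < k then xs ! m < x else x < xs ! m)"

lemma cuts_intermediate_value:
  assumes "sorted_wrt (<) xs" "xs \<noteq> []" "k \<le> length xs"
  shows "cuts xs k (intermediate_value xs k)"
proof -
  have less: "xs ! i < xs ! j" if "i < j" "j < length xs" for i j
    using assms(1) that by (simp add: sorted_wrt_iff_nth_less)
  then have le: "xs ! i \<le> xs ! j" if "i \<le> j" "j < length xs" for i j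
    using that by (cases "i = j") (auto intro: less_imp_le)
  show ?thesis
  proof (cases "k = 0 \<or> k = length xs")
    case True
    have "hd xs \<le> xs ! m \<and> xs ! m \<le> last xs" if "m < length xs" for m
      using that le[of 0 m] le[of m "length xs - 1"] assms(2) by (simp add: hd_conv_nth last_conv_nth)
    then have "hd xs - 1 < xs ! m \<and> xs ! m < last xs + 1" if "m < length xs" for m
      using that by fastforce
    then show ?thesis using True assms(2) by (auto simp: cuts_def intermediate_value_def)
  next
    case False
    then have k: "0 < k" "k < length xs" using assms(3) by auto
    have "xs ! m < (xs ! (k - 1) + xs ! k) / 2" if "m < k" for m
      using le[of m "k - 1"] less[of "k - 1" k] k that by fastforce
    moreover have "(xs ! (k - 1) + xs ! k) / 2 < xs ! m" if "k \<le> m" "m < length xs" for m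
      using le[of k m] less[of "k - 1" k] k that by fastforce
    ultimately show ?thesis using k by (auto simp: cuts_def intermediate_value_def)
  qed
qed

lemma cuts_exists:
  assumes "sorted xs" "x \<notin> set xs"
  shows "\<exists>k. cuts xs k x"
proof -
  let ?k = "length (takeWhile (\<lambda>e. e < x) xs)"
  have "xs ! m < x" if "m < ?k" for m
    using that nth_mem[of m "takeWhile (\<lambda>e. e < x) xs"]
    by (metis set_takeWhileD takeWhile_nth)
  moreover have "x < xs ! m" if "\<not> m < ?k" "m < length xs" for m
  proof -
    have "xs ! ?k \<le> xs ! m" using that assms(1) by (simp add: sorted_nth_mono)
    moreover have "\<not> xs ! ?k < x" using nth_length_takeWhile[of "\<lambda>e. e < x" xs] that by simp
    moreover have "xs ! m \<noteq> x" using assms(2) that(2) by (metis nth_mem)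
    ultimately show ?thesis by linarith
  qed
  ultimately have "cuts xs ?k x" by (auto simp: cuts_def length_takeWhile_le)
  then show ?thesis ..
qed

lemma cuts_less: "cuts xs k x \<Longrightarrow> cuts xs l y \<Longrightarrow> k < l \<Longrightarrow> x < y"
  unfolding cuts_def by (metis less_le_trans less_irrefl less_trans)

lemma cuts_notin: "cuts xs k x \<Longrightarrow> x \<notin> set xs"
  unfolding cuts_def by (metis in_set_conv_nth less_irrefl)

lemma cuts_interval: "cuts xs k x \<Longrightarrow> cuts xs k y \<Longrightarrow> {x..y} \<inter> set xs = {}"
  unfolding cuts_def in_set_conv_nth disjoint_iff atLeastAtMost_iff by (metis not_le)

lemma filter_sum_mset: "filter_mset P (\<Sum>i\<in>I. M i) = (\<Sum>i\<in>I. filter_mset P (M i))"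
  by (induction I rule: infinite_finite_induct) auto

lemma image_mset_sum: "image_mset h (\<Sum>i\<in>I. M i) = (\<Sum>i\<in>I. image_mset h (M i))"
  by (induction I rule: infinite_finite_induct) auto

lemma filter_replicate_mset: "filter_mset P (replicate_mset m a) = (if P a then replicate_mset m a else {#})"
  by (induction m) auto

lemma mset_sumD: "x \<in># (\<Sum>i\<in>I. M i) \<Longrightarrow> \<exists>i\<in>I. x \<in># M i"
  by (induction I rule: infinite_finite_induct) auto

lemma rank_diagram_mem:
  assumes "finite E" "(b, d) \<in># rank_diagram r E"
  shows "b \<in> E" "d = \<infinity> \<or> (\<exists>e\<in>E. d = ereal e \<and> b < e)"
proof -
  define xs where "xs = sorted_list_of_set E"
  have xs: "set xs = E" "sorted_wrt (<) xs" using assms(1) by (auto simp: xs_def)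
  have less: "xs ! i < xs ! j" if "i < j" "j < length xs" for i j
    using xs(2) that by (simp add: sorted_wrt_iff_nth_less)
  have mem: "xs ! (i - 1) \<in> E" if "i \<in> {1..length xs}" for i using that xs(1) by (auto intro!: nth_mem)
  consider (finite) i j where "i \<in> {1..length xs}" "j \<in> {i<..length xs}"
      "b = xs ! (i - 1)" "d = ereal (xs ! (j - 1))"
    | (infinite) i where "i \<in> {1..length xs}" "b = xs ! (i - 1)" "d = \<infinity>"
    using assms(2) unfolding rank_diagram_def Let_def xs_def[symmetric] union_iff
    by (elim disjE) (drule mset_sumD, (erule bexE)?, (drule mset_sumD)?, (erule bexE)?,
      force simp: in_replicate_mset split: if_splits)+
  then have "b \<in> E \<and> (d = \<infinity> \<or> (\<exists>e\<in>E. d = ereal e \<and> b < e))"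
  proof cases
    case finite
    then show ?thesis using mem[of i] mem[of j] less[of "i - 1" "j - 1"] by auto
  next
    case infinite
    then show ?thesis using mem by simp
  qed
  then show "b \<in> E" "d = \<infinity> \<or> (\<exists>e\<in>E. d = ereal e \<and> b < e)" by auto
qed

text \<open>What the counting of points takes from homology. Constancy off \<open>E\<close> gives
  independence of the intermediate values, \<open>supermodular\<close> and \<open>mono_left\<close>
  make the integers under \<open>nat\<close> nonnegative, and \<open>zero_below\<close> lets the
  telescoping sum start at 0. The condition \<open>y \<notin> E\<close> marks where finite dimension
  is available.\<close>

locale rank_function =
  fixes r :: "real \<Rightarrow> real \<Rightarrow> nat" and E :: "real set"
  assumes finite_exceptional: "finite E"
    and const_left: "x \<le> x' \<Longrightarrow> x' \<le> y \<Longrightarrow> {x..x'} \<inter> E = {} \<Longrightarrow> r x y = r x' y"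
    and const_right: "x \<le> y \<Longrightarrow> y \<le> y' \<Longrightarrow> {y..y'} \<inter> E = {} \<Longrightarrow> r x y = r x y'"
    and supermodular: "w \<le> x \<Longrightarrow> x \<le> y \<Longrightarrow> y \<le> z \<Longrightarrow> y \<notin> E \<Longrightarrow> r w y + r x z \<le> r x y + r w z"
    and mono_left: "w \<le> x \<Longrightarrow> x \<le> y \<Longrightarrow> y \<notin> E \<Longrightarrow> r w y \<le> r x y"
    and zero_below: "(\<And>e. e \<in> E \<Longrightarrow> x < e) \<Longrightarrow> x \<le> y \<Longrightarrow> r x y = 0"
begin

abbreviation "exc \<equiv> sorted_list_of_set E"

lemma set_exc: "set exc = E" and sorted_exc: "sorted exc" "sorted_wrt (<) exc"
  using finite_exceptional by auto

text \<open>One end is moved at a time within its gap. The intermediate pair uses the larger of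
  \<open>y\<close> and \<open>y'\<close>, which keeps it ordered as the constancy laws
  require.\<close>

lemma rank_cuts:
  assumes "cuts exc k x" "cuts exc k x'" "cuts exc l y" "cuts exc l y'" "x \<le> y" "x' \<le> y'"
  shows "r x y = r x' y'"
proof -
  have *: "r x y = r x' y'" if "cuts exc k x" "cuts exc k x'" "cuts exc l y" "cuts exc l y'"
    "x \<le> y" "x' \<le> y'" "x \<le> x'" for x x' y y'
  proof (cases "y \<le> y'")
    case True
    with that have "r x y = r x y'"
      using const_right[of x y y'] cuts_interval[of exc l y y'] set_exc by auto
    also have "\<dots> = r x' y'"
      using const_left[of x x' y'] cuts_interval[of exc k x x'] set_exc that by auto
    finally show ?thesis .
  next
    case False
    then have "r x' y' = r x' y"
      using const_right[of x' y' y] cuts_interval[of exc l y' y] set_exc that by auto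
    also have "\<dots> = r x y"
      using const_left[of x x' y] cuts_interval[of exc k x x'] set_exc that False by auto
    finally show ?thesis ..
  qed
  show ?thesis
  proof (cases "x \<le> x'")
    case True
    then show ?thesis using * assms by blast
  next
    case False
    then show ?thesis using *[of x' x y' y] assms by simp
  qed
qed

text \<open>Multiplicities of finite points are mixed second differences of \<beta>, so summing them
  over a quadrant telescopes in both indices. The boundary term at \<open>N\<close> is made up for
  by the points at infinity, and the one at 0 vanishes.\<close>

lemma size_rank_diagram:
  assumes "x \<le> y" "x \<notin> E" "y \<notin> E"
  shows "size (filter_mset (\<lambda>(b, d). b < x \<and> ereal y < d) (rank_diagram r E)) = r x y"
proof (cases "exc = []")
  case True
  then have "E = {}" using set_exc by simp
  then show ?thesis using zero_below assms(1) by (simp add: rank_diagram_def)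
next
  case False
  define N where "N = length exc"
  define s where "s = intermediate_value exc"
  define \<beta> where "\<beta> = (\<lambda>i j. int (r (s i) (s j)))"
  define m where "m = (\<lambda>i j. \<beta> i (j - 1) - \<beta> (i - 1) (j - 1) - \<beta> i j + \<beta> (i - 1) j)"
  define m' where "m' = (\<lambda>i. \<beta> i N - \<beta> (i - 1) N)"
  have cut: "cuts exc k (s k)" if "k \<le> N" for k
    using cuts_intermediate_value[OF sorted_exc(2) False] that by (simp add: N_def s_def)
  have s_mono: "s k \<le> s l" if "k \<le> l" "l \<le> N" for k l
    using cuts_less[OF cut cut, of k l] that by (cases "k = l") auto
  have s_notin: "s k \<notin> E" if "k \<le> N" for k using cuts_notin[OF cut[OF that]] set_exc by simp
  obtain i where i: "cuts exc i x" using cuts_exists[OF sorted_exc(1), of x] assms(2) set_exc by auto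
  obtain j where j: "cuts exc j y" using cuts_exists[OF sorted_exc(1), of y] assms(3) set_exc by auto
  have iN: "i \<le> N" "j \<le> N" using i j by (auto simp: cuts_def N_def)
  have ij: "i \<le> j"
  proof (rule ccontr)
    assume "\<not> i \<le> j"
    then show False using cuts_less[OF j i] assms(1) by simp
  qed
  \<comment> \<open>Truncation by \<open>nat\<close> would destroy the telescoping; by these two
    facts it never occurs.\<close>
  have m_nonneg: "0 \<le> m k l" if "k \<in> {1..N}" "l \<in> {k<..N}" for k l
    using supermodular[of "s (k - 1)" "s k" "s (l - 1)" "s l"] that s_mono s_notin
    by (auto simp: m_def \<beta>_def)
  have m'_nonneg: "0 \<le> m' k" if "k \<in> {1..N}" for k
    using mono_left[of "s (k - 1)" "s k" "s N"] that s_mono s_notin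
    by (auto simp: m'_def \<beta>_def)
  \<comment> \<open>Exceptional values are numbered from 1 but list entries from 0. With
    \<open>x\<close> in gap \<open>i\<close> and \<open>y\<close> in gap \<open>j\<close>, the
    counted points have birth index at most \<open>i\<close> and death index above
    \<open>j\<close>.\<close>
  have ax: "exc ! (k - 1) < x \<longleftrightarrow> k \<le> i" if "k \<in> {1..N}" for k
  proof -
    have "k - 1 < length exc" using that by (auto simp: N_def)
    with i have "if k - 1 < i then exc ! (k - 1) < x else x < exc ! (k - 1)" unfolding cuts_def by blast
    moreover have "k - 1 < i \<longleftrightarrow> k \<le> i" using that by auto
    ultimately show ?thesis by (auto split: if_splits)
  qed
  have ay: "y < exc ! (k - 1) \<longleftrightarrow> j < k" if "k \<in> {1..N}" for k
  proof -
    have "k - 1 < length exc" using that by (auto simp: N_def)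
    with j have "if k - 1 < j then exc ! (k - 1) < y else y < exc ! (k - 1)" unfolding cuts_def by blast
    moreover have "k - 1 < j \<longleftrightarrow> k \<le> j" using that by auto
    ultimately show ?thesis by (auto split: if_splits)
  qed
  have "int (size (filter_mset (\<lambda>(b, d). b < x \<and> ereal y < d) (rank_diagram r E)))
    = (\<Sum>k\<in>{1..N}. \<Sum>l\<in>{k<..N}. if exc ! (k - 1) < x \<and> y < exc ! (l - 1) then int (nat (m k l)) else 0)
      + (\<Sum>k\<in>{1..N}. if exc ! (k - 1) < x then int (nat (m' k)) else 0)"
    unfolding rank_diagram_def Let_def N_def[symmetric] s_def[symmetric]
    by (simp add: filter_sum_mset size_multiset_sum filter_replicate_mset m_def m'_def \<beta>_def
        if_distrib[of size] if_distrib[of int] cong: if_cong)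
  also have "(\<Sum>k\<in>{1..N}. \<Sum>l\<in>{k<..N}. if exc ! (k - 1) < x \<and> y < exc ! (l - 1) then int (nat (m k l)) else 0)
    = (\<Sum>k\<in>{1..N}. if k \<le> i then (\<Sum>l\<in>{k<..N}. if j < l then m k l else 0) else 0)"
  proof (intro sum.cong refl)
    fix k assume k: "k \<in> {1..N}"
    have "(if exc ! (k - 1) < x \<and> y < exc ! (l - 1) then int (nat (m k l)) else 0)
      = (if k \<le> i then (if j < l then m k l else 0) else 0)" if "l \<in> {k<..N}" for l
      using ax[OF k] ay[of l] m_nonneg[OF k that] that by auto
    then show "(\<Sum>l\<in>{k<..N}. if exc ! (k - 1) < x \<and> y < exc ! (l - 1) then int (nat (m k l)) else 0)
      = (if k \<le> i then (\<Sum>l\<in>{k<..N}. if j < l then m k l else 0) else 0)"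
      by simp
  qed
  also have "\<dots> = (\<Sum>k\<in>{1..i}. \<Sum>l\<in>{k<..N}. if j < l then m k l else 0)"
    using iN by (intro sum.mono_neutral_cong_right) auto
  \<comment> \<open>As k \<le> i \<le> j, the condition j < l already implies k < l, so the
    triangular index range becomes a rectangle.\<close>
  also have "\<dots> = (\<Sum>k\<in>{1..i}. \<Sum>l\<in>{j<..N}. m k l)"
    using ij by (intro sum.cong refl sum.mono_neutral_cong_right) auto
  \<comment> \<open>The sum over \<open>l\<close> telescopes from \<open>j\<close> to
    \<open>N\<close>. What it leaves at \<open>N\<close> is \<open>m' k\<close>, the multiplicity of
    the point at infinity born at the \<open>k\<close>-th value.\<close>
  also have "\<dots> = (\<Sum>k\<in>{1..i}. \<beta> k j - \<beta> (k - 1) j - m' k)"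
  proof (intro sum.cong refl)
    fix k
    have "(\<Sum>l\<in>{j<..N}. m k l) = (\<Sum>l\<in>{j<..N}. (\<beta> k (l - 1) - \<beta> (k - 1) (l - 1)) - (\<beta> k l - \<beta> (k - 1) l))"
      by (intro sum.cong refl) (simp add: m_def)
    also have "\<dots> = (\<beta> k j - \<beta> (k - 1) j) - (\<beta> k N - \<beta> (k - 1) N)"
      using iN(2) by (induction rule: dec_induct) (auto simp: atLeastSucAtMost_greaterThanAtMost[symmetric])
    finally show "(\<Sum>l\<in>{j<..N}. m k l) = \<beta> k j - \<beta> (k - 1) j - m' k" by (simp add: m'_def)
  qed
  also have "(\<Sum>k\<in>{1..N}. if exc ! (k - 1) < x then int (nat (m' k)) else 0) = (\<Sum>k\<in>{1..i}. m' k)"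
  proof (intro sum.mono_neutral_cong_right)
    show "\<forall>k\<in>{1..N} - {1..i}. (if exc ! (k - 1) < x then int (nat (m' k)) else 0) = 0"
      using ax by auto
    show "(if exc ! (k - 1) < x then int (nat (m' k)) else 0) = m' k" if "k \<in> {1..i}" for k
      using ax[of k] m'_nonneg[of k] that iN(1) by auto
  qed (use iN in auto)
  also have "(\<Sum>k\<in>{1..i}. \<beta> k j - \<beta> (k - 1) j - m' k) + (\<Sum>k\<in>{1..i}. m' k)
    = (\<Sum>k\<in>{1..i}. \<beta> k j - \<beta> (k - 1) j)"
    by (simp add: sum_subtractf)
  also have "\<dots> = \<beta> i j - \<beta> 0 j"
    by (induction i) auto
  \<comment> \<open>\<open>s 0\<close> lies below every exceptional value.\<close>
  also have "\<beta> 0 j = 0"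
  proof -
    have "s 0 < e" if "e \<in> E" for e
    proof -
      obtain m where "m < length exc" "exc ! m = e" using \<open>e \<in> E\<close> set_exc by (metis in_set_conv_nth)
      then show ?thesis using cut[of 0] unfolding cuts_def by auto
    qed
    then show ?thesis using zero_below[of "s 0" "s j"] s_mono iN by (simp add: \<beta>_def)
  qed
  also have "\<beta> i j = int (r x y)"
    unfolding \<beta>_def using rank_cuts[OF cut i cut j] s_mono iN ij assms(1) by simp
  finally show ?thesis by simp
qed

text \<open>The outermost intermediate values are offset by 1 and hence do not scale by
  \<open>c\<close>. They still lie in the same gaps as the scaled ones, and \<open>rank_cuts\<close>
  shows that the ranks agree.\<close>

lemma rank_diagram_scale:
  assumes "c > 0" and r': "\<And>x y. r' (c * x) (c * y) = r x y"
    and "rank_function r' ((*) c ` E)"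
  shows "rank_diagram r' ((*) c ` E) = image_mset (\<lambda>(b, d). (c * b, ereal c * d)) (rank_diagram r E)"
proof -
  interpret r': rank_function r' "(*) c ` E" by fact
  define N where "N = length exc"
  define s where "s = intermediate_value exc"
  define s' where "s' = intermediate_value r'.exc"
  have xs': "r'.exc = map ((*) c) exc"
  proof (rule strict_sorted_equal)
    show "sorted_wrt (<) (map ((*) c) exc)"
      using sorted_exc(2) assms(1) by (simp add: sorted_wrt_map)
    show "sorted_wrt (<) r'.exc" by (rule r'.sorted_exc(2))
    show "set r'.exc = set (map ((*) c) exc)" using r'.set_exc set_exc by simp
  qed
  have rank: "r' (s' i) (s' j) = r (s i) (s j)" if "i \<le> j" "j \<le> N" "N \<noteq> 0" for i j
  proof -
    have ne: "exc \<noteq> []" using that(3) unfolding N_def by (metis list.size(3))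
    then have ne': "r'.exc \<noteq> []" by (simp add: xs')
    have cut: "cuts exc k (s k)" if "k \<le> N" for k
      using cuts_intermediate_value[OF sorted_exc(2) ne] that by (simp add: N_def s_def)
    then have cut1: "cuts r'.exc k (c * s k)" if "k \<le> N" for k
      using that assms(1) by (auto simp: cuts_def xs' split: if_splits)
    have cut2: "cuts r'.exc k (s' k)" if "k \<le> N" for k
      using cuts_intermediate_value[OF r'.sorted_exc(2) ne'] that by (simp add: N_def s'_def xs')
    have "s i \<le> s j" using cuts_less[OF cut cut, of i j] that by (cases "i = j") auto
    moreover have "s' i \<le> s' j" using cuts_less[OF cut2 cut2, of i j] that by (cases "i = j") auto
    ultimately have "r' (s' i) (s' j) = r' (c * s i) (c * s j)"
      using that assms(1) by (intro r'.rank_cuts[OF cut2 cut1 cut2 cut1]) auto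
    then show ?thesis by (simp add: r')
  qed
  have L: "length r'.exc = N" by (simp add: xs' N_def)
  have nth: "r'.exc ! (k - 1) = c * exc ! (k - 1)" if "k \<in> {1..N}" for k
    using that by (auto simp: xs' N_def)
  show ?thesis
    using assms(1) unfolding rank_diagram_def Let_def L N_def[symmetric] s_def[symmetric] s'_def[symmetric]
      image_mset_union image_mset_sum
    by (intro arg_cong2[of _ _ _ _ "(+)"] sum.cong refl)
      (auto simp: rank nth[unfolded One_nat_def])
qed

end

section \<open>Rank functions of tame functions\<close>

definition sublevel_set :: "'a set \<Rightarrow> ('a \<Rightarrow> real) \<Rightarrow> real \<Rightarrow> 'a set" where
  "sublevel_set X f a = {x \<in> X. f x \<le> a}"

lemma sublevel_set_mono: "a \<le> b \<Longrightarrow> sublevel_set X f a \<subseteq> sublevel_set X f b"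
  by (auto simp: sublevel_set_def)

lemma pers_space_eq: "pers_space F n X f a = hspace F n (sublevel_set X f a)"
  by (simp add: pers_space_def hspace_def sublevel_def sublevel_set_def)

lemma pers_map_eq: "pers_map F n X f a b = hmap n (sublevel_set X f b)"
  unfolding pers_map_def hmap_def sublevel_def sublevel_set_def by (rule refl)

lemma pers_rank_eq: "pers_rank F n X f a b = hrank F n (sublevel_set X f a) (sublevel_set X f b)"
  by (simp add: pers_rank_def hrank_def pers_space_eq pers_map_eq)

lemma regular_value_iff:
  fixes F :: "'k::field itself"
  shows "regular_value F n X f a \<longleftrightarrow> (\<exists>l u. l < a \<and> a < u \<and>
    (\<forall>s\<in>{l<..<u}. hfin F n (sublevel_set X f s)) \<and>
    (\<forall>s\<in>{l<..<u}. \<forall>t\<in>{l<..<u}. s \<le> t \<longrightarrow>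
       bij_betw (hmap n (sublevel_set X f t)) (carrier (hspace F n (sublevel_set X f s))) (carrier (hspace F n (sublevel_set X f t)))))"
proof -
  have "linear_map class_ring (hspace F n (sublevel_set X f s)) (hspace F n (sublevel_set X f t)) (hmap n (sublevel_set X f t))"
    if "s \<le> t" for s t
    by (rule hmap_linear[OF sublevel_set_mono[OF that]])
  then show ?thesis unfolding regular_value_def pers_space_eq pers_map_eq by meson
qed

lemma regular_hfin: "regular_value F n X f a \<Longrightarrow> hfin F n (sublevel_set X f a)"
  by (auto simp: regular_value_iff)

text \<open>Regularity is local. \<open>Bolzano\<close> makes it global on the interval: the
  isomorphisms compose, and around every point all short inclusions induce isomorphisms.\<close>

lemma regular_interval_iso:
  assumes "a \<le> b" "\<And>c. a \<le> c \<Longrightarrow> c \<le> b \<Longrightarrow> regular_value F n X f c"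
  shows "bij_betw (hmap n (sublevel_set X f b)) (carrier (hspace F n (sublevel_set X f a))) (carrier (hspace F n (sublevel_set X f b)))"
  using assms(1)
proof (induction rule: Bolzano)
  case (trans a b c)
  have "bij_betw (hmap n (sublevel_set X f c) \<circ> hmap n (sublevel_set X f b))
    (carrier (hspace F n (sublevel_set X f a))) (carrier (hspace F n (sublevel_set X f c)))"
    by (rule bij_betw_trans[OF trans(1,2)])
  then show ?case
    by (rule bij_betw_cong[THEN iffD1, rotated]) (simp add: hmap_hmap[OF sublevel_set_mono[OF trans(3)] sublevel_set_mono[OF trans(4)], where F = F])
next
  case (local x)
  then have "regular_value F n X f x" using assms(2) by blast
  then obtain l u where lu: "l < x" "x < u" and
    bij: "\<And>s t. s \<in> {l<..<u} \<Longrightarrow> t \<in> {l<..<u} \<Longrightarrow> s \<le> t \<Longrightarrow>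
       bij_betw (hmap n (sublevel_set X f t)) (carrier (hspace F n (sublevel_set X f s))) (carrier (hspace F n (sublevel_set X f t)))"
    unfolding regular_value_iff by blast
  show ?case
  proof (intro exI[of _ "min (x - l) (u - x)"] conjI allI impI)
    fix a b assume "a \<le> x \<and> x \<le> b \<and> b - a < min (x - l) (u - x)"
    then show "bij_betw (hmap n (sublevel_set X f b)) (carrier (hspace F n (sublevel_set X f a))) (carrier (hspace F n (sublevel_set X f b)))"
      by (intro bij) auto
  qed (use lu in auto)
qed

lemma regular_value_const:
  assumes "l < a" "a < u" "\<And>s. l < s \<Longrightarrow> s < u \<Longrightarrow> sublevel_set X f s = A" "hfin F n A"
  shows "regular_value F n X f a"
  unfolding regular_value_iff
proof (rule exI[of _ l], rule exI[of _ u], intro conjI ballI impI)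
  fix s t assume st: "s \<in> {l<..<u}" "t \<in> {l<..<u}" "s \<le> t"
  have "bij_betw (\<lambda>x. x) (carrier (hspace F n A)) (carrier (hspace F n A))" by (simp add: bij_betw_def)
  then have "bij_betw (hmap n A) (carrier (hspace F n A)) (carrier (hspace F n A))"
    by (rule bij_betw_cong[THEN iffD1, rotated]) (simp add: hmap_id)
  then show "bij_betw (hmap n (sublevel_set X f t)) (carrier (hspace F n (sublevel_set X f s))) (carrier (hspace F n (sublevel_set X f t)))"
    using st assms(3) by simp
qed (use assms in auto)

text \<open>The bound \<open>B\<close> is all that is kept of compactness and continuity: sublevel
  sets are empty below \<open>- B\<close> and equal to \<open>X\<close> from \<open>B\<close>
  on.\<close>

locale tame_bounded =
  fixes F :: "'k::field itself" and n :: nat and X :: "'a::topological_space set"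
    and f :: "'a \<Rightarrow> real" and B :: real
  assumes tame: "tame F n X f" and bounded: "\<And>x. x \<in> X \<Longrightarrow> \<bar>f x\<bar> \<le> B"
begin

abbreviation "E \<equiv> exceptional_values F n X f"
abbreviation "r \<equiv> pers_rank F n X f"

lemma finite_E: "finite E"
  using tame by (simp add: tame_def)

lemma not_E: "a \<notin> E \<Longrightarrow> regular_value F n X f a"
  by (simp add: exceptional_values_def)

lemma sublevel_set_below: "a < - B \<Longrightarrow> sublevel_set X f a = {}"
  using bounded by (force simp: sublevel_set_def)

lemma sublevel_set_above: "B \<le> a \<Longrightarrow> sublevel_set X f a = X"
  using bounded by (force simp: sublevel_set_def)

lemma exceptional_bounded:
  assumes "e \<in> E"
  shows "- B \<le> e" "e \<le> B"
proof -
  have nreg: "\<not> regular_value F n X f e" using assms by (simp add: exceptional_values_def)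
  show "- B \<le> e"
  proof (rule ccontr)
    assume "\<not> - B \<le> e"
    then have "regular_value F n X f e"
      by (intro regular_value_const[of "e - 1" _ "- B" _ _ "{}"]) (auto simp: sublevel_set_below hspace_empty)
    with nreg show False ..
  qed
  show "e \<le> B"
  proof (rule ccontr)
    assume e: "\<not> e \<le> B"
    \<comment> \<open>Finite dimension of the homology of \<open>X\<close> itself has to come from
      tameness: finitely many exceptional values leave a regular one above \<open>B\<close>.\<close>
    have "infinite {B<..}" by (rule infinite_Ioi)
    then obtain a where "B < a" "a \<notin> E" using finite_E by (meson finite_subset greaterThan_iff subsetI)
    then have "hfin F n X" using regular_hfin[OF not_E] sublevel_set_above[of a] by force
    then have "regular_value F n X f e"
      using e by (intro regular_value_const[of B _ "e + 1" _ _ X]) (auto simp: sublevel_set_above)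
    with nreg show False ..
  qed
qed

lemma iso:
  assumes "a \<le> b" "{a..b} \<inter> E = {}"
  shows "bij_betw (hmap n (sublevel_set X f b)) (carrier (hspace F n (sublevel_set X f a))) (carrier (hspace F n (sublevel_set X f b)))"
  using assms by (intro regular_interval_iso not_E) auto

sublocale rank_function r E
proof
  show "finite E" by (rule finite_E)
  show left: "r x y = r x' y" if "x \<le> x'" "x' \<le> y" "{x..x'} \<inter> E = {}" for x x' y
    unfolding pers_rank_eq using iso[OF that(1,3)] that
    by (intro hrank_surj sublevel_set_mono) (auto simp: bij_betw_def)
  show "r x y = r x y'" if "x \<le> y" "y \<le> y'" "{y..y'} \<inter> E = {}" for x y y'
  proof -
    have "y \<notin> E" using that by auto
    then show ?thesis
      unfolding pers_rank_eq using iso[OF that(2,3)] that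
      by (intro hrank_inj[symmetric] sublevel_set_mono regular_hfin not_E) (auto simp: bij_betw_def)
  qed
  show "r w y + r x z \<le> r x y + r w z" if "w \<le> x" "x \<le> y" "y \<le> z" "y \<notin> E" for w x y z
    unfolding pers_rank_eq using that by (intro hrank_supermodular sublevel_set_mono regular_hfin not_E)
  show "r w y \<le> r x y" if "w \<le> x" "x \<le> y" "y \<notin> E" for w x y
    unfolding pers_rank_eq using that by (intro hrank_mono sublevel_set_mono regular_hfin not_E) auto
  show "r x y = 0" if "\<And>e. e \<in> E \<Longrightarrow> x < e" "x \<le> y" for x y
  proof -
    \<comment> \<open>A point at or below \<open>x\<close> whose sublevel set is empty. No
      exceptional value lies between \<open>z\<close> and \<open>x\<close>, so the rank is the same
      as at \<open>z\<close>.\<close>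
    define z where "z = min x (- B - 1)"
    have "r x y = r z y"
      using left[of z x y] that by (force simp: z_def)
    also have "\<dots> = 0"
      using sublevel_set_below[of z] by (simp add: pers_rank_eq z_def hspace_empty)
    finally show ?thesis .
  qed
qed

lemma diagram_eq: "persistence_diagram F n X f = rank_diagram r E"
  unfolding persistence_diagram_def rank_diagram_def ..

end

text \<open>The sublevel sets of f at a, g at a + \<epsilon>, g at b - \<epsilon> and f at b form an
  increasing chain, so \<open>hrank_mono\<close> applies. Regularity at b - \<epsilon> provides the
  finite dimension.\<close>

lemma rank_interleaving:
  assumes "\<And>x. x \<in> X \<Longrightarrow> \<bar>f x - g x\<bar> \<le> \<epsilon>" "a + \<epsilon> \<le> b - \<epsilon>" "regular_value F n X g (b - \<epsilon>)"
  shows "pers_rank F n X f a b \<le> pers_rank F n X g (a + \<epsilon>) (b - \<epsilon>)"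
  unfolding pers_rank_eq
proof (rule hrank_mono[OF _ sublevel_set_mono _ regular_hfin])
  show "sublevel_set X f a \<subseteq> sublevel_set X g (a + \<epsilon>)" "sublevel_set X g (b - \<epsilon>) \<subseteq> sublevel_set X f b"
    using assms(1) by (fastforce simp: sublevel_set_def)+
qed fact+

section \<open>Scaling a function by a positive constant\<close>

lemma sublevel_set_scale: "c > 0 \<Longrightarrow> sublevel_set X (\<lambda>x. c * f x) (c * a) = sublevel_set X f a"
  by (simp add: sublevel_set_def)

lemma regular_value_scale:
  assumes "c > 0" "regular_value F n X f a"
  shows "regular_value F n X (\<lambda>x. c * f x) (c * a)"
proof -
  from assms(2) obtain l u where lu: "l < a" "a < u"
    and fin: "\<forall>s\<in>{l<..<u}. hfin F n (sublevel_set X f s)"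
    and bij: "\<forall>s\<in>{l<..<u}. \<forall>t\<in>{l<..<u}. s \<le> t \<longrightarrow>
       bij_betw (hmap n (sublevel_set X f t)) (carrier (hspace F n (sublevel_set X f s))) (carrier (hspace F n (sublevel_set X f t)))"
    unfolding regular_value_iff by blast
  have s: "\<exists>s'\<in>{l<..<u}. s = c * s'" if "s \<in> {c * l<..<c * u}" for s
    using that assms(1) by (intro bexI[of _ "s / c"]) (auto simp: field_simps)
  show ?thesis unfolding regular_value_iff
  proof (rule exI[of _ "c * l"], rule exI[of _ "c * u"], intro conjI ballI impI)
    show "hfin F n (sublevel_set X (\<lambda>x. c * f x) s)" if "s \<in> {c * l<..<c * u}" for s
      using s[OF that] fin by (auto simp: sublevel_set_scale[OF assms(1)])
    show "bij_betw (hmap n (sublevel_set X (\<lambda>x. c * f x) t)) (carrier (hspace F n (sublevel_set X (\<lambda>x. c * f x) s)))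
      (carrier (hspace F n (sublevel_set X (\<lambda>x. c * f x) t)))"
      if "s \<in> {c * l<..<c * u}" "t \<in> {c * l<..<c * u}" "s \<le> t" for s t
      using s[OF that(1)] s[OF that(2)] that(3) bij assms(1) by (auto simp: sublevel_set_scale[OF assms(1)])
  qed (use lu assms(1) in auto)
qed

lemma exceptional_values_scale:
  assumes "c > 0"
  shows "exceptional_values F n X (\<lambda>x. c * f x) = (*) c ` exceptional_values F n X f"
proof -
  have "regular_value F n X (\<lambda>x. c * f x) (c * a) \<longleftrightarrow> regular_value F n X f a" for a
    using regular_value_scale[OF assms, of F n X f a]
      regular_value_scale[of "1 / c" F n X "\<lambda>x. c * f x" "c * a"] assms by auto
  then have *: "c * a \<in> exceptional_values F n X (\<lambda>x. c * f x) \<longleftrightarrow> a \<in> exceptional_values F n X f" for a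
    by (simp add: exceptional_values_def)
  have "b \<in> (*) c ` exceptional_values F n X f" if "b \<in> exceptional_values F n X (\<lambda>x. c * f x)" for b
    using *[of "b / c"] that assms by (intro image_eqI[of _ _ "b / c"]) auto
  then show ?thesis using * by blast
qed

context tame_bounded
begin

lemma scale: "c > 0 \<Longrightarrow> tame_bounded F n X (\<lambda>x. c * f x) (c * B)"
  using bounded finite_E
  by unfold_locales (auto simp: tame_def exceptional_values_scale abs_mult)

lemma diagram_scale:
  assumes "c > 0"
  shows "persistence_diagram F n X (\<lambda>x. c * f x)
    = image_mset (\<lambda>(b, d). (c * b, ereal c * d)) (persistence_diagram F n X f)"
proof -
  interpret S: tame_bounded F n X "\<lambda>x. c * f x" "c * B" by (rule scale[OF assms])
  have "rank_diagram S.r ((*) c ` E) = image_mset (\<lambda>(b, d). (c * b, ereal c * d)) (rank_diagram r E)"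
    using S.rank_function_axioms
    by (intro rank_diagram_scale[OF assms])
      (simp_all add: pers_rank_eq sublevel_set_scale[OF assms] exceptional_values_scale[OF assms])
  then show ?thesis by (simp add: diagram_eq S.diagram_eq exceptional_values_scale[OF assms])
qed

end

section \<open>Landscapes\<close>

text \<open>In a descending list the entries that are at least \<open>v\<close> form an initial
  segment, whose length is compared with \<open>m\<close>.\<close>

lemma descending_nth_ge_iff:
  fixes v :: real
  assumes "sorted_wrt (\<ge>) vs" "1 \<le> m"
  shows "m \<le> length vs \<and> v \<le> vs ! (m - 1) \<longleftrightarrow> m \<le> length (filter (\<lambda>w. v \<le> w) vs)"
  using assms
proof (induction vs arbitrary: m)
  case Nil
  then show ?case by simp
next
  case (Cons w ws)
  show ?case
  proof (cases "v \<le> w")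
    case True
    show ?thesis
    proof (cases "m = 1")
      case False
      then have "m - 1 - 1 = m - 2" "1 \<le> m - 1" "(w # ws) ! (m - 1) = ws ! (m - 2)"
        using Cons.prems by (auto simp: nth_Cons' numeral_2_eq_2)
      then show ?thesis using Cons True by force
    qed (use True in auto)
  next
    case False
    then have less: "\<not> v \<le> u" if "u \<in> set (w # ws)" for u using that Cons.prems(1) by auto
    then have "filter (\<lambda>u. v \<le> u) (w # ws) = []" by (auto simp: filter_empty_conv)
    moreover have "\<not> v \<le> (w # ws) ! (m - 1)" if "m \<le> length (w # ws)"
      using that Cons.prems(2) by (intro less nth_mem) auto
    ultimately show ?thesis using Cons.prems(2) by auto
  qed
qed

lemma tent_ereal: "tent t (b, ereal d) = max (min (t - b) (d - t)) 0"
  by (simp add: tent_def flip: ereal_min ereal_max zero_ereal_def)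
    (simp add: zero_ereal_def max_def min_def)

lemma tent_PInf: "tent t (b, \<infinity>) = max (t - b) 0"
  by (simp add: tent_def zero_ereal_def max_def min_def)

lemma tent_MInf: "tent t (b, - \<infinity>) = 0"
  by (simp add: tent_def max_def min_def)

lemma tent_nonneg: "0 \<le> tent t x"
  by (cases x; cases "snd x") (auto simp: tent_ereal tent_PInf tent_MInf)

text \<open>Describes superlevel sets of tents by closed quadrants of the diagram with corner (t -
  v, t + v). \<open>size_rank_diagram\<close> counts the points in open quadrants.\<close>

lemma tent_ge_iff:
  assumes "v > 0"
  shows "v \<le> tent t (b, d) \<longleftrightarrow> b \<le> t - v \<and> ereal (t + v) \<le> d"
  using assms by (cases d) (auto simp: tent_ereal tent_PInf tent_MInf)

lemma tent_measurable [measurable]: "(\<lambda>t. tent t x) \<in> borel_measurable borel"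
  by (cases x; cases "snd x") (auto simp: tent_ereal tent_PInf tent_MInf)

definition tent_list :: "diagram \<Rightarrow> real \<Rightarrow> real list" where
  "tent_list D t = rev (sorted_list_of_multiset (image_mset (tent t) D))"

lemma mset_tent_list: "mset (tent_list D t) = image_mset (tent t) D"
  by (simp add: tent_list_def)

lemma length_tent_list: "length (tent_list D t) = size D"
  using arg_cong[OF mset_tent_list, of size] by simp

lemma landscape_tent_list:
  "landscape D m t = (if 1 \<le> m \<and> m \<le> size D then tent_list D t ! (m - 1) else 0)"
  unfolding landscape_def Let_def tent_list_def[symmetric] length_tent_list ..

lemma landscape_nonneg: "0 \<le> landscape D m t"
proof -
  have "0 \<le> w" if "w \<in> set (tent_list D t)" for w
    using that tent_nonneg unfolding set_mset_mset[symmetric] mset_tent_list by auto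
  then show ?thesis by (auto simp: landscape_tent_list length_tent_list intro!: nth_mem)
qed

text \<open>Translates landscapes into counts of points. Positivity of \<open>v\<close> matters
  because the landscape has the default value 0 when \<open>m\<close> exceeds
  \<open>size D\<close>.\<close>

lemma landscape_ge_iff:
  assumes "v > 0" "1 \<le> m"
  shows "v \<le> landscape D m t \<longleftrightarrow> m \<le> size (filter_mset (\<lambda>x. v \<le> tent t x) D)"
proof -
  have "sorted_wrt (\<ge>) (tent_list D t)"
    by (simp add: tent_list_def sorted_wrt_rev)
  note descending_nth_ge_iff[OF this assms(2), of v]
  also have "length (filter (\<lambda>w. v \<le> w) (tent_list D t)) = size (filter_mset (\<lambda>x. v \<le> tent t x) D)"
    using arg_cong[OF mset_tent_list[of D t], of "\<lambda>M. size (filter_mset (\<lambda>w. v \<le> w) M)"]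
    by (simp add: filter_mset_image_mset flip: size_mset mset_filter)
  finally show ?thesis using assms by (auto simp: landscape_tent_list length_tent_list)
qed

text \<open>At a fixed \<open>t\<close> the landscape values are the tent values in another order.
  The sum over all levels thus turns into a sum over the points of the diagram.\<close>

lemma sum_landscape:
  assumes "\<phi> 0 = 0"
  shows "(\<Sum>j<size D. \<phi> (landscape D (Suc j) t)) = (\<Sum>x\<in>#D. \<phi> (tent t x))"
proof -
  have "(\<Sum>x\<in>#D. \<phi> (tent t x)) = sum_mset (image_mset \<phi> (image_mset (tent t) D))"
    by (simp add: multiset.map_comp comp_def)
  also have "\<dots> = sum_list (map \<phi> (tent_list D t))"
    by (metis mset_map mset_tent_list sum_mset_sum_list)
  also have "\<dots> = (\<Sum>j<size D. \<phi> (landscape D (Suc j) t))"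
    by (simp add: sum_list_sum_nth length_tent_list landscape_tent_list atLeast0LessThan)
  finally show ?thesis ..
qed

text \<open>By \<open>landscape_ge_iff\<close> the superlevel sets are given by a counting function,
  which is a finite sum of indicators of superlevel sets of tents.\<close>

lemma landscape_measurable [measurable]: "landscape D m \<in> borel_measurable borel"
proof -
  have count: "(\<lambda>t. real (size (filter_mset (\<lambda>x. a \<le> tent t x) D))) \<in> borel_measurable borel" for a
  proof (induction D)
    case (add x D)
    have "(\<lambda>t. real (size (filter_mset (\<lambda>x. a \<le> tent t x) (add_mset x D))))
      = (\<lambda>t. real (size (filter_mset (\<lambda>x. a \<le> tent t x) D)) + indicator {t. a \<le> tent t x} t)"
      by (auto simp: indicator_def fun_eq_iff)
    moreover have "{t. a \<le> tent t x} \<in> sets borel" by measurable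
    ultimately show ?case using add by simp
  qed simp
  have "{t. a \<le> landscape D m t} \<in> sets borel" for a
  proof (cases "a > 0 \<and> 1 \<le> m")
    case True
    then have "{t. a \<le> landscape D m t} = {t. real m \<le> real (size (filter_mset (\<lambda>x. a \<le> tent t x) D))}"
      by (simp add: landscape_ge_iff)
    also have "\<dots> \<in> sets borel" using count[of a] by measurable
    finally show ?thesis .
  next
    case False
    then consider "a \<le> 0" | "a > 0" "m = 0" by linarith
    then show ?thesis
    proof cases
      case 1
      then have "{t. a \<le> landscape D m t} = UNIV" using order_trans[OF _ landscape_nonneg] by blast
      then show ?thesis by simp
    next
      case 2
      then have "{t. a \<le> landscape D m t} = {}" by (simp add: landscape_tent_list)
      then show ?thesis by simp
    qed
  qed
  then show ?thesis by (simp add: borel_measurable_iff_ge)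
qed

text \<open>\<open>Pers\<close> in real arithmetic. A point with infinite death would be counted
  with death 0, so the value is meaningful only for diagrams without such points.\<close>

definition real_pers :: "real \<Rightarrow> diagram \<Rightarrow> real" where
  "real_pers q D = (\<Sum>(b, d)\<in>#D. (real_of_ereal d - b) powr q)"

lemma Pers_eq: "Pers q D = (if \<exists>b. (b, \<infinity>) \<in># D then \<infinity> else ereal (real_pers q D))"
  unfolding Pers_def real_pers_def
  by (induction D) (auto simp: zero_ereal_def)

lemma sum_mset_nonneg: "(\<And>x. x \<in># D \<Longrightarrow> 0 \<le> u x) \<Longrightarrow> 0 \<le> (\<Sum>x\<in>#D. u x :: real)"
  by (induction D) auto

lemma real_pers_nonneg: "0 \<le> real_pers q D"
  unfolding real_pers_def by (auto intro!: sum_mset_nonneg)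

section \<open>Integrals of truncated tents and landscapes\<close>

text \<open>Here \<open>s\<close> is the height along one flank of a tent of height
  \<open>h\<close>, so \<open>2 * h\<close> is the persistence of its point, and the factor 1/2 in
  the bound is the share of one flank. The integrand is a power up to height min \<epsilon> h and
  constant from \<epsilon> to \<open>h\<close>.\<close>

lemma truncated_powr_integral:
  fixes \<epsilon> h k p M :: real
  assumes "0 \<le> \<epsilon>" "0 \<le> h" "1 \<le> k" "k \<le> p" "h - \<epsilon> \<le> M" "0 \<le> M"
  shows "(\<integral>\<^sup>+ s. ennreal (min \<epsilon> s powr p * indicator {0..h} s) \<partial>lborel)
    \<le> ennreal (rpow \<epsilon> (p - k) * (M * (2 * h) powr k + (2 * h) powr (k + 1) / (p + 1)) / 2)"
proof (cases "\<epsilon> = 0")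
  \<comment> \<open>The integrand is 0. Treating this case apart leaves \<epsilon> > 0, where
    \<open>rpow\<close> and \<open>powr\<close> agree even for exponent 0.\<close>
  case True
  then have "(\<lambda>s. ennreal (min \<epsilon> s powr p * indicator {0..h} s)) = (\<lambda>_. 0)"
    by (auto simp: indicator_def fun_eq_iff)
  then show ?thesis by simp
next
  case False
  with assms have e: "\<epsilon> > 0" by simp
  define c where "c = min \<epsilon> h"
  have c: "0 \<le> c" "c \<le> \<epsilon>" "c \<le> h" using assms by (auto simp: c_def)
  have "(\<integral>\<^sup>+ s. ennreal (min \<epsilon> s powr p * indicator {0..h} s) \<partial>lborel)
    \<le> (\<integral>\<^sup>+ s. ennreal (s powr p * indicator {0..c} s) + ennreal (\<epsilon> powr p) * indicator {\<epsilon>..h} s \<partial>lborel)"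
    by (intro nn_integral_mono) (auto simp: indicator_def c_def min_def)
  also have "\<dots> = (\<integral>\<^sup>+ s. ennreal (s powr p * indicator {0..c} s) \<partial>lborel)
      + (\<integral>\<^sup>+ s. ennreal (\<epsilon> powr p) * indicator {\<epsilon>..h} s \<partial>lborel)"
    by (rule nn_integral_add) auto
  also have "(\<integral>\<^sup>+ s. ennreal (s powr p * indicator {0..c} s) \<partial>lborel) = ennreal (c powr (p + 1) / (p + 1))"
  proof (rule nn_integral_has_integral_lborel)
    have "((\<lambda>s. s powr p) has_integral c powr (p + 1) / (p + 1)) {0..c}"
      by (rule has_integral_powr_from_0) (use assms c in auto)
    then have "((\<lambda>s. if s \<in> {0..c} then s powr p else 0) has_integral c powr (p + 1) / (p + 1)) UNIV"
      unfolding has_integral_restrict_UNIV .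
    then show "((\<lambda>s. s powr p * indicator {0..c} s) has_integral c powr (p + 1) / (p + 1)) UNIV"
      by (rule has_integral_eq[rotated]) (auto simp: indicator_def)
  qed auto
  also have "(\<integral>\<^sup>+ s. ennreal (\<epsilon> powr p) * indicator {\<epsilon>..h} s \<partial>lborel) = ennreal (\<epsilon> powr p * max 0 (h - \<epsilon>))"
    by (cases "\<epsilon> \<le> h") (auto simp: nn_integral_cmult_indicator ennreal_mult' max_def)
  also have "ennreal (c powr (p + 1) / (p + 1)) + ennreal (\<epsilon> powr p * max 0 (h - \<epsilon>))
    = ennreal (c powr (p + 1) / (p + 1) + \<epsilon> powr p * max 0 (h - \<epsilon>))"
    using assms by (intro ennreal_plus[symmetric]) auto
  also have "\<dots> \<le> ennreal (rpow \<epsilon> (p - k) * (M * (2 * h) powr k + (2 * h) powr (k + 1) / (p + 1)) / 2)"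
  proof (rule ennreal_leI)
    have rp: "rpow \<epsilon> (p - k) = \<epsilon> powr (p - k)" using e by (simp add: rpow_def)
    \<comment> \<open>This produces the factor 1/2: passing from heights to persistences gains 2
      powr a, which is at least 2.\<close>
    have two: "2 * h powr a \<le> (2 * h) powr a" if "1 \<le> a" for a
      using powr_mono[of 1 a 2] that assms(2) by (simp add: powr_mult mult_right_mono)
    have split: "x powr (p - k) * x powr a = x powr (p - k + a)" for x a by (simp add: powr_add)
    \<comment> \<open>An exponent \<open>p - k\<close> is split off and its base bounded by
      \<epsilon>. The remaining powers are bounded by powers of \<open>h\<close>, and the length h -
      \<epsilon> of the plateau by \<open>M\<close>.\<close>
    have "c powr (p + 1) = c powr (p - k) * c powr (k + 1)" by (simp add: split)
    also have "\<dots> \<le> \<epsilon> powr (p - k) * ((2 * h) powr (k + 1) / 2)"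
      using powr_mono2[of "k + 1" c h] powr_mono2[of "p - k" c \<epsilon>] two[of "k + 1"] c assms
      by (intro mult_mono) auto
    finally have 1: "c powr (p + 1) / (p + 1) \<le> \<epsilon> powr (p - k) * ((2 * h) powr (k + 1) / 2) / (p + 1)"
      using assms by (intro divide_right_mono) auto
    have "\<epsilon> powr p * max 0 (h - \<epsilon>) = \<epsilon> powr (p - k) * (\<epsilon> powr k * max 0 (h - \<epsilon>))" by (simp add: split)
    also have "\<epsilon> powr k * max 0 (h - \<epsilon>) \<le> (2 * h) powr k / 2 * M"
    proof (cases "\<epsilon> \<le> h")
      case True
      then show ?thesis
        using powr_mono2[of k \<epsilon> h] two[of k] assms by (intro mult_mono) auto
    qed (use assms in auto)
    finally have 2: "\<epsilon> powr p * max 0 (h - \<epsilon>) \<le> \<epsilon> powr (p - k) * ((2 * h) powr k / 2 * M)"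
      by (simp add: mult_left_mono)
    have "\<epsilon> powr (p - k) * ((2 * h) powr (k + 1) / 2) / (p + 1) + \<epsilon> powr (p - k) * ((2 * h) powr k / 2 * M)
      = rpow \<epsilon> (p - k) * (M * (2 * h) powr k + (2 * h) powr (k + 1) / (p + 1)) / 2"
    proof -
      have "a * (x / 2) / q + a * (z / 2 * M) = a * (M * z + x / q) / 2" for a x z q :: real
        by (cases "q = 0") (simp_all add: field_simps)
      then show ?thesis unfolding rp .
    qed
    then show "c powr (p + 1) / (p + 1) + \<epsilon> powr p * max 0 (h - \<epsilon>)
      \<le> rpow \<epsilon> (p - k) * (M * (2 * h) powr k + (2 * h) powr (k + 1) / (p + 1)) / 2"
      using 1 2 by linarith
  qed
  finally show ?thesis .
qed

lemma tent_integral: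
  fixes \<epsilon> b d k p M :: real
  assumes "0 \<le> \<epsilon>" "b \<le> d" "1 \<le> k" "k \<le> p" "(d - b) / 2 - \<epsilon> \<le> M" "0 \<le> M"
  shows "(\<integral>\<^sup>+ t. ennreal (min \<epsilon> (tent t (b, ereal d)) powr p) \<partial>lborel)
    \<le> ennreal (rpow \<epsilon> (p - k) * (M * (d - b) powr k + (d - b) powr (k + 1) / (p + 1)))"
proof -
  define h where "h = (d - b) / 2"
  define \<Phi> where "\<Phi> = (\<lambda>s. ennreal (min \<epsilon> s powr p * indicator {0..h} s))"
  have [measurable]: "\<Phi> \<in> borel_measurable borel" unfolding \<Phi>_def by measurable
  let ?A = "rpow \<epsilon> (p - k) * (M * (2 * h) powr k + (2 * h) powr (k + 1) / (p + 1))"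
  have "0 \<le> ?A" using assms by (auto simp: rpow_def intro!: mult_nonneg_nonneg add_nonneg_nonneg divide_nonneg_nonneg)
  have "(\<integral>\<^sup>+ t. ennreal (min \<epsilon> (tent t (b, ereal d)) powr p) \<partial>lborel)
    \<le> (\<integral>\<^sup>+ t. \<Phi> (- b + 1 * t) + \<Phi> (d + (- 1) * t) \<partial>lborel)"
  proof (rule nn_integral_mono)
    fix t
    consider "b \<le> t" "t - b \<le> h" | "t \<le> d" "d - t \<le> h" | "t < b \<or> d < t" by (fastforce simp: h_def field_simps)
    then show "ennreal (min \<epsilon> (tent t (b, ereal d)) powr p) \<le> \<Phi> (- b + 1 * t) + \<Phi> (d + (- 1) * t)"
    proof cases
      case 1
      then have "ennreal (min \<epsilon> (tent t (b, ereal d)) powr p) = \<Phi> (- b + 1 * t)"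
        by (auto simp: tent_ereal \<Phi>_def h_def field_simps)
      then show ?thesis by simp
    next
      case 2
      then have "ennreal (min \<epsilon> (tent t (b, ereal d)) powr p) = \<Phi> (d + (- 1) * t)"
        by (auto simp: tent_ereal \<Phi>_def h_def field_simps)
      then show ?thesis by simp
    next
      case 3
      then have "tent t (b, ereal d) = 0" by (auto simp: tent_ereal)
      then show ?thesis using assms(1) by simp
    qed
  qed
  also have "\<dots> = (\<integral>\<^sup>+ t. \<Phi> (- b + 1 * t) \<partial>lborel) + (\<integral>\<^sup>+ t. \<Phi> (d + (- 1) * t) \<partial>lborel)"
    by (rule nn_integral_add) measurable
  also have "\<dots> = integral\<^sup>N lborel \<Phi> + integral\<^sup>N lborel \<Phi>"
    using nn_integral_real_affine[of \<Phi> 1 "- b"] nn_integral_real_affine[of \<Phi> "-1" d] by simp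
  also have "\<dots> \<le> ennreal (?A / 2) + ennreal (?A / 2)"
    unfolding \<Phi>_def by (intro add_mono truncated_powr_integral) (use assms in \<open>auto simp: h_def\<close>)
  also have "\<dots> = ennreal ?A"
    using \<open>0 \<le> ?A\<close> by (subst ennreal_plus[symmetric]) auto
  also have "2 * h = d - b" by (simp add: h_def)
  finally show ?thesis .
qed

lemma nn_integral_sum_mset:
  assumes "\<And>x. x \<in># D \<Longrightarrow> u x \<in> borel_measurable M"
  shows "(\<integral>\<^sup>+ t. (\<Sum>x\<in>#D. u x t) \<partial>M) = (\<Sum>x\<in>#D. \<integral>\<^sup>+ t. u x t \<partial>M)"
    and "(\<lambda>t. \<Sum>x\<in>#D. u x t) \<in> borel_measurable M"
  using assms by (induction D) (auto simp: nn_integral_add)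

lemma sum_mset_ennreal: "(\<And>x. x \<in># D \<Longrightarrow> 0 \<le> u x) \<Longrightarrow> (\<Sum>x\<in>#D. ennreal (u x)) = ennreal (\<Sum>x\<in>#D. u x)"
  by (induction D) (auto simp: sum_mset_nonneg ennreal_plus[symmetric] simp del: ennreal_plus)

lemma truncated_landscape_integral:
  fixes \<epsilon> k p M :: real
  assumes "0 \<le> \<epsilon>" "1 \<le> k" "k \<le> p" "0 \<le> M"
    and D: "\<And>b d. (b, d) \<in># D \<Longrightarrow> \<exists>e. d = ereal e \<and> b \<le> e \<and> (e - b) / 2 - \<epsilon> \<le> M"
  shows "suminf (\<lambda>j. \<integral>\<^sup>+ t. ennreal (min \<epsilon> (landscape D (Suc j) t) powr p) \<partial>lborel)
    \<le> ennreal (rpow \<epsilon> (p - k) * (M * real_pers k D + real_pers (k + 1) D / (p + 1)))"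
proof -
  let ?\<phi> = "\<lambda>s. ennreal (min \<epsilon> s powr p)"
  let ?R = "rpow \<epsilon> (p - k)"
  let ?B = "\<lambda>(b, d). ?R * (M * (real_of_ereal d - b) powr k + (real_of_ereal d - b) powr (k + 1) / (p + 1))"
  have \<phi>0: "?\<phi> 0 = 0" using assms(1) by simp
  \<comment> \<open>Levels beyond \<open>size D\<close> contribute 0, so the series is a finite sum
    and commutes with the integral.\<close>
  have "suminf (\<lambda>j. \<integral>\<^sup>+ t. ?\<phi> (landscape D (Suc j) t) \<partial>lborel)
    = (\<Sum>j<size D. \<integral>\<^sup>+ t. ?\<phi> (landscape D (Suc j) t) \<partial>lborel)"
    by (rule suminf_finite) (use \<phi>0 in \<open>auto simp: landscape_tent_list\<close>)
  also have "\<dots> = (\<integral>\<^sup>+ t. (\<Sum>j<size D. ?\<phi> (landscape D (Suc j) t)) \<partial>lborel)"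
    by (rule nn_integral_sum[symmetric]) measurable
  also have "\<dots> = (\<integral>\<^sup>+ t. (\<Sum>x\<in>#D. ?\<phi> (tent t x)) \<partial>lborel)"
    unfolding sum_landscape[where \<phi> = ?\<phi>, OF \<phi>0] ..
  also have "\<dots> = (\<Sum>x\<in>#D. \<integral>\<^sup>+ t. ?\<phi> (tent t x) \<partial>lborel)"
    by (rule nn_integral_sum_mset) measurable
  also have "\<dots> \<le> (\<Sum>x\<in>#D. ennreal (?B x))"
  proof (rule sum_mset_mono)
    fix x assume "x \<in># D"
    then obtain b e where x: "x = (b, ereal e)" "b \<le> e" "(e - b) / 2 - \<epsilon> \<le> M"
      using D by (cases x) blast
    show "(\<integral>\<^sup>+ t. ?\<phi> (tent t x) \<partial>lborel) \<le> ennreal (?B x)"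
      using tent_integral[OF assms(1) x(2) assms(2,3) x(3) assms(4)] by (simp add: x(1))
  qed
  also have "\<dots> = ennreal (\<Sum>x\<in>#D. ?B x)"
    by (rule sum_mset_ennreal)
      (use assms in \<open>auto simp: rpow_def intro!: mult_nonneg_nonneg add_nonneg_nonneg divide_nonneg_nonneg\<close>)
  also have "(\<Sum>x\<in>#D. ?B x) = ?R * (M * real_pers k D + real_pers (k + 1) D / (p + 1))"
    unfolding real_pers_def
    by (induction D) (auto simp: algebra_simps add_divide_distrib)
  finally show ?thesis .
qed

lemma landscape_distance_bound:
  fixes \<epsilon> k p M :: real
  assumes "0 \<le> \<epsilon>" "1 \<le> k" "k \<le> p" "0 \<le> M"
    and D: "\<And>b d. (b, d) \<in># D + D' \<Longrightarrow> \<exists>e. d = ereal e \<and> b \<le> e \<and> (e - b) / 2 - \<epsilon> \<le> M"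
    and close: "\<And>j t. \<bar>landscape D (Suc j) t - landscape D' (Suc j) t\<bar> \<le> \<epsilon>"
  shows "suminf (\<lambda>j. \<integral>\<^sup>+ t. ennreal (\<bar>landscape D (Suc j) t - landscape D' (Suc j) t\<bar> powr p) \<partial>lborel)
    \<le> ennreal ((M * (real_pers k D + real_pers k D')
        + (real_pers (k + 1) D + real_pers (k + 1) D') / (p + 1)) * rpow \<epsilon> (p - k))"
proof -
  let ?I = "\<lambda>D. suminf (\<lambda>j. \<integral>\<^sup>+ t. ennreal (min \<epsilon> (landscape D (Suc j) t) powr p) \<partial>lborel)"
  let ?A = "\<lambda>D. rpow \<epsilon> (p - k) * (M * real_pers k D + real_pers (k + 1) D / (p + 1))"
  have A: "0 \<le> ?A D" for D
    using assms real_pers_nonneg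
    by (auto simp: rpow_def intro!: mult_nonneg_nonneg add_nonneg_nonneg divide_nonneg_nonneg)
  have "suminf (\<lambda>j. \<integral>\<^sup>+ t. ennreal (\<bar>landscape D (Suc j) t - landscape D' (Suc j) t\<bar> powr p) \<partial>lborel)
    \<le> suminf (\<lambda>j. (\<integral>\<^sup>+ t. ennreal (min \<epsilon> (landscape D (Suc j) t) powr p) \<partial>lborel)
        + (\<integral>\<^sup>+ t. ennreal (min \<epsilon> (landscape D' (Suc j) t) powr p) \<partial>lborel))"
  proof (rule suminf_le)
    fix j
    have "(\<integral>\<^sup>+ t. ennreal (\<bar>landscape D (Suc j) t - landscape D' (Suc j) t\<bar> powr p) \<partial>lborel)
      \<le> (\<integral>\<^sup>+ t. ennreal (min \<epsilon> (landscape D (Suc j) t) powr p)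
          + ennreal (min \<epsilon> (landscape D' (Suc j) t) powr p) \<partial>lborel)"
    proof (rule nn_integral_mono)
      fix t
      let ?x = "landscape D (Suc j) t" and ?y = "landscape D' (Suc j) t"
      have xy: "0 \<le> ?x" "0 \<le> ?y" by (rule landscape_nonneg)+
      \<comment> \<open>The difference of two nonnegative numbers is at most the larger of them, and
        here also at most \<epsilon>.\<close>
      have "\<bar>?x - ?y\<bar> \<le> min \<epsilon> ?x \<or> \<bar>?x - ?y\<bar> \<le> min \<epsilon> ?y" using xy close[of j t] by auto
      then have "\<bar>?x - ?y\<bar> powr p \<le> min \<epsilon> ?x powr p \<or> \<bar>?x - ?y\<bar> powr p \<le> min \<epsilon> ?y powr p"
        using assms(2,3) by (auto intro: powr_mono2)
      then have "\<bar>?x - ?y\<bar> powr p \<le> min \<epsilon> ?x powr p + min \<epsilon> ?y powr p"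
        using powr_ge_zero[of "min \<epsilon> ?x" p] powr_ge_zero[of "min \<epsilon> ?y" p] by linarith
      then show "ennreal (\<bar>?x - ?y\<bar> powr p) \<le> ennreal (min \<epsilon> ?x powr p) + ennreal (min \<epsilon> ?y powr p)"
        by (simp add: ennreal_plus[symmetric] ennreal_leI del: ennreal_plus)
    qed
    also have "\<dots> = (\<integral>\<^sup>+ t. ennreal (min \<epsilon> (landscape D (Suc j) t) powr p) \<partial>lborel)
        + (\<integral>\<^sup>+ t. ennreal (min \<epsilon> (landscape D' (Suc j) t) powr p) \<partial>lborel)"
      by (rule nn_integral_add) measurable
    finally show "(\<integral>\<^sup>+ t. ennreal (\<bar>landscape D (Suc j) t - landscape D' (Suc j) t\<bar> powr p) \<partial>lborel)
      \<le> (\<integral>\<^sup>+ t. ennreal (min \<epsilon> (landscape D (Suc j) t) powr p) \<partial>lborel)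
        + (\<integral>\<^sup>+ t. ennreal (min \<epsilon> (landscape D' (Suc j) t) powr p) \<partial>lborel)" .
  qed auto
  also have "\<dots> = ?I D + ?I D'" by (rule suminf_add[symmetric]) auto
  also have "\<dots> \<le> ennreal (?A D) + ennreal (?A D')"
    by (intro add_mono truncated_landscape_integral assms D) auto
  also have "\<dots> = ennreal (?A D + ?A D')" by (rule ennreal_plus[symmetric]) (rule A)+
  also have "?A D + ?A D' = (M * (real_pers k D + real_pers k D')
        + (real_pers (k + 1) D + real_pers (k + 1) D') / (p + 1)) * rpow \<epsilon> (p - k)"
    by (simp add: algebra_simps add_divide_distrib)
  finally show ?thesis .
qed

lemma ennreal_powr_inverse:
  assumes "p > 0"
  shows "ennreal_powr (ennreal_powr x (1 / p)) p = x"
  using assms by (cases x) (auto simp: ennreal_powr_def powr_powr)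

section \<open>Stability\<close>

lemma size_filter_mset_mono:
  "(\<And>x. x \<in># D \<Longrightarrow> P x \<Longrightarrow> Q x) \<Longrightarrow> size (filter_mset P D) \<le> size (filter_mset Q D)"
  by (induction D) (auto simp: le_Suc_eq)

text \<open>
  The diagrams count ranks only at nonexceptional values, so the argument uses a generic \<open>\<rho>\<close> slightly
  below the value of the landscape.
\<close>

lemma landscape_stability_le:
  assumes f: "tame_bounded F n X f B" and g: "tame_bounded F n X g B'"
    and close: "\<And>x. x \<in> X \<Longrightarrow> \<bar>f x - g x\<bar> \<le> \<epsilon>" and "0 \<le> \<epsilon>" "1 \<le> m"
  shows "landscape (persistence_diagram F n X f) m t \<le> landscape (persistence_diagram F n X g) m t + \<epsilon>"
proof (rule ccontr)
  interpret f: tame_bounded F n X f B by (rule f)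
  interpret g: tame_bounded F n X g B' by (rule g)
  let ?D = "persistence_diagram F n X f" and ?D' = "persistence_diagram F n X g"
  let ?v = "landscape ?D m t" and ?w = "landscape ?D' m t"
  assume "\<not> ?v \<le> ?w + \<epsilon>"
  then have vw: "?w + \<epsilon> < ?v" by simp
  \<comment> \<open>The values of \<rho> for which one of the four levels compared below is
    exceptional, for \<open>f\<close> at t - \<rho> and t + \<rho> or for \<open>g\<close> at the
    levels moved inwards by \<epsilon>. Being finite, \<open>S\<close> does not exhaust the open
    interval left by the assumed failure.\<close>
  define S where "S = (\<lambda>e. t - e) ` f.E \<union> (\<lambda>e. e - t) ` f.E \<union> (\<lambda>e. t + \<epsilon> - e) ` g.E \<union> (\<lambda>e. e - t + \<epsilon>) ` g.E"
  have "finite S" using f.finite_E g.finite_E by (simp add: S_def)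
  moreover have "infinite {?w + \<epsilon><..<?v}" using vw by (simp add: infinite_Ioo)
  ultimately obtain \<rho> where \<rho>: "?w + \<epsilon> < \<rho>" "\<rho> < ?v" "\<rho> \<notin> S"
    by (meson finite_subset greaterThanLessThan_iff subsetI)
  have notE: "t - \<rho> \<notin> f.E" "t + \<rho> \<notin> f.E" "t - \<rho> + \<epsilon> \<notin> g.E" "t + \<rho> - \<epsilon> \<notin> g.E"
    using \<rho>(3) unfolding S_def by (force simp: image_iff)+
  have w: "0 \<le> ?w" by (rule landscape_nonneg)
  have pos: "0 < ?v" "0 < \<rho> - \<epsilon>" "0 < \<rho>" using vw \<rho> w assms(4) by linarith+
  have "m \<le> size (filter_mset (\<lambda>x. ?v \<le> tent t x) ?D)"
    using landscape_ge_iff[OF pos(1) assms(5)] by blast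
  \<comment> \<open>The closed quadrant at height \<open>?v\<close> lies in the open one at height
    \<rho> because \<rho> is strictly smaller.\<close>
  also have "\<dots> \<le> size (filter_mset (\<lambda>(b, d). b < t - \<rho> \<and> ereal (t + \<rho>) < d) ?D)"
  proof (rule size_filter_mset_mono)
    fix x assume x: "?v \<le> tent t x"
    obtain b d where [simp]: "x = (b, d)" by (cases x)
    from x have "b \<le> t - ?v" "ereal (t + ?v) \<le> d" using tent_ge_iff[OF pos(1)] by auto
    then have "b < t - \<rho>" "ereal (t + \<rho>) < d"
      using \<rho>(2) less_le_trans[of "ereal (t + \<rho>)" "ereal (t + ?v)" d] by auto
    then show "case x of (b, d) \<Rightarrow> b < t - \<rho> \<and> ereal (t + \<rho>) < d" by simp
  qed
  also have "\<dots> = f.r (t - \<rho>) (t + \<rho>)"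
    unfolding f.diagram_eq by (rule f.size_rank_diagram) (use pos notE in auto)
  also have "\<dots> \<le> g.r (t - \<rho> + \<epsilon>) (t + \<rho> - \<epsilon>)"
    by (rule rank_interleaving) (use close pos notE g.not_E in auto)
  also have "\<dots> = size (filter_mset (\<lambda>(b, d). b < t - \<rho> + \<epsilon> \<and> ereal (t + \<rho> - \<epsilon>) < d) ?D')"
    unfolding g.diagram_eq by (rule g.size_rank_diagram[symmetric]) (use pos notE in auto)
  also have "\<dots> \<le> size (filter_mset (\<lambda>x. \<rho> - \<epsilon> \<le> tent t x) ?D')"
  proof (rule size_filter_mset_mono)
    fix x assume x: "case x of (b, d) \<Rightarrow> b < t - \<rho> + \<epsilon> \<and> ereal (t + \<rho> - \<epsilon>) < d"
    obtain b d where [simp]: "x = (b, d)" by (cases x)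
    have "ereal (t + (\<rho> - \<epsilon>)) \<le> d" using x by (simp add: add_diff_eq less_imp_le)
    then show "\<rho> - \<epsilon> \<le> tent t x" using x by (simp add: tent_ge_iff[OF pos(2)])
  qed
  finally have "\<rho> - \<epsilon> \<le> ?w" using landscape_ge_iff[OF pos(2) assms(5)] by blast
  then show False using \<rho>(1) by simp
qed

lemma landscape_stability:
  assumes "tame_bounded F n X f B" "tame_bounded F n X g B'"
    and "\<And>x. x \<in> X \<Longrightarrow> \<bar>f x - g x\<bar> \<le> \<epsilon>" "0 \<le> \<epsilon>" "1 \<le> m"
  shows "\<bar>landscape (persistence_diagram F n X f) m t - landscape (persistence_diagram F n X g) m t\<bar> \<le> \<epsilon>"
  using landscape_stability_le[OF assms, of t]
    landscape_stability_le[OF assms(2,1) _ assms(4,5), of t] assms(3)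
  by (fastforce simp: abs_minus_commute abs_le_iff)

section \<open>Total persistence in terms of the Lipschitz constant\<close>

lemma real_pers_scale:
  assumes "c > 0" "\<And>b d. (b, d) \<in># D \<Longrightarrow> \<exists>e. d = ereal e \<and> b < e"
  shows "real_pers q (image_mset (\<lambda>(b, d). (c * b, ereal c * d)) D) = c powr q * real_pers q D"
proof -
  have "(case x of (b, d) \<Rightarrow> (real_of_ereal (ereal c * d) - c * b) powr q)
    = c powr q * (case x of (b, d) \<Rightarrow> (real_of_ereal d - b) powr q)" if "x \<in># D" for x
  proof -
    obtain b d where "x = (b, d)" by (cases x)
    with assms(2)[of b d] that obtain e where x: "x = (b, ereal e)" "b < e" by blast
    have "(c * e - c * b) powr q = c powr q * (e - b) powr q"
      using x(2) assms(1) by (simp add: powr_mult flip: right_diff_distrib)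
    then show ?thesis by (simp add: x(1))
  qed
  then have "image_mset (\<lambda>x. case x of (b, d) \<Rightarrow> (real_of_ereal (ereal c * d) - c * b) powr q) D
    = image_mset (\<lambda>x. c powr q * (case x of (b, d) \<Rightarrow> (real_of_ereal d - b) powr q)) D"
    by (rule image_mset_cong)
  then show ?thesis
    by (simp add: real_pers_def multiset.map_comp comp_def case_prod_unfold sum_mset_distrib_left)
qed

lemma Lip_nonneg: "Lipschitz_function X f \<Longrightarrow> 0 \<le> Lip X f"
  unfolding Lip_def Lipschitz_function_def
  by (rule cInf_greatest) (auto simp: lipschitz_on_def)

lemma Lip_less_imp_lipschitz:
  assumes "Lipschitz_function X f" "Lip X f < c"
  shows "0 < c" "c-lipschitz_on X f"
proof -
  have ne: "{c. c-lipschitz_on X f} \<noteq> {}" using assms(1) by (auto simp: Lipschitz_function_def)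
  show "0 < c" using Lip_nonneg[OF assms(1)] assms(2) by simp
  obtain c' where "c'-lipschitz_on X f" "c' < c"
    using cInf_lessD[OF ne, of c] assms(2) by (auto simp: Lip_def)
  then show "c-lipschitz_on X f" using lipschitz_on_le by fastforce
qed

lemma Lip_le: "c-lipschitz_on X f \<Longrightarrow> Lip X f \<le> c"
  unfolding Lip_def by (rule cInf_lower) (auto intro!: bdd_belowI[of _ 0] simp: lipschitz_on_def)

text \<open>Birth and death are both exceptional values, which lie between \<open>- B\<close> and
  \<open>B\<close>.\<close>

lemma diagram_mem:
  assumes "tame_bounded F n X f B" "(b, d) \<in># persistence_diagram F n X f" "d \<noteq> \<infinity>"
  shows "\<exists>e. d = ereal e \<and> b < e \<and> (e - b) / 2 \<le> B"
proof -
  interpret tame_bounded F n X f B by (rule assms(1))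
  have "b \<in> E" "\<exists>e\<in>E. d = ereal e \<and> b < e"
    using rank_diagram_mem[OF finite_E, of b d r] assms(2,3) by (auto simp: diagram_eq)
  then show ?thesis using exceptional_bounded by fastforce
qed

text \<open>The hypothesis is applied to f / c and the result scaled back. Taking \<open>c\<close>
  strictly above the infimum makes it a positive Lipschitz constant, also when
  \<open>Lip X f\<close> is 0.\<close>

lemma total_persistence_scaled:
  fixes X :: "'a::metric_space set"
  assumes f: "tame_bounded F n X f B"
    and C: "total_persistence_bound F n X q C" "Lipschitz_function X f" "Lip X f < c"
  shows "(b, \<infinity>) \<notin># persistence_diagram F n X f"
    and "real_pers q (persistence_diagram F n X f) \<le> C * c powr q"
proof -
  interpret tame_bounded F n X f B by (rule f)
  let ?D = "persistence_diagram F n X f"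
  have c: "0 < c" "c-lipschitz_on X f" using Lip_less_imp_lipschitz[OF C(2,3)] by auto
  then have ic: "0 < 1 / c" by simp
  let ?h = "\<lambda>x. 1 / c * f x"
  interpret h: tame_bounded F n X ?h "1 / c * B" by (rule scale[OF ic])
  have "1-lipschitz_on X ?h"
  proof (rule lipschitz_onI)
    fix x y assume "x \<in> X" "y \<in> X"
    then have "\<bar>f x - f y\<bar> \<le> c * dist x y" using lipschitz_onD[OF c(2)] by (simp add: dist_real_def)
    moreover have "dist (?h x) (?h y) = \<bar>f x - f y\<bar> / c"
      using c(1) by (simp add: dist_real_def flip: diff_divide_distrib)
    ultimately show "dist (?h x) (?h y) \<le> 1 * dist x y"
      using c(1) by (simp add: pos_divide_le_eq mult.commute)
  qed simp
  then have "Lip X ?h \<le> 1" "Lipschitz_function X ?h"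
    by (rule Lip_le) (use \<open>1-lipschitz_on X ?h\<close> in \<open>unfold Lipschitz_function_def, rule exI\<close>)
  then have "Pers q (persistence_diagram F n X ?h) \<le> ereal C"
    by (intro C(1)[unfolded total_persistence_bound_def, rule_format] conjI h.tame)
  moreover define D' where "D' = image_mset (\<lambda>(b, d). (1 / c * b, ereal (1 / c) * d)) ?D"
  ultimately have P: "Pers q D' \<le> ereal C" by (simp only: diagram_scale[OF ic])
  \<comment> \<open>A real bound on \<open>Pers\<close> excludes infinite deaths, and scaling
    carries this over to the diagram of \<open>f\<close>.\<close>
  then have fin: "(b, \<infinity>) \<notin># D'" for b
    by (auto simp: Pers_eq split: if_splits)
  show inf: "(b, \<infinity>) \<notin># ?D" for b
  proof
    assume "(b, \<infinity>) \<in># ?D"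
    then have "(case (b, \<infinity>) of (b, d) \<Rightarrow> (1 / c * b, ereal (1 / c) * d))
      \<in># D'" unfolding D'_def
      by (rule imageI[of _ "set_mset ?D", folded set_image_mset])
    then show False using fin[of "1 / c * b"] ic by simp
  qed
  have mem: "\<exists>e. d = ereal e \<and> b < e" if "(b, d) \<in># ?D" for b d
    using diagram_mem[OF f that] inf that by blast
  have "(1 / c) powr q * real_pers q ?D \<le> C"
  proof -
    have "real_pers q D' = (1 / c) powr q * real_pers q ?D"
      unfolding D'_def by (rule real_pers_scale[OF ic]) (rule mem)
    then show ?thesis using P fin unfolding Pers_eq by simp
  qed
  then show "real_pers q ?D \<le> C * c powr q"
    using c(1) by (simp add: powr_divide field_simps)
qed

text \<open>Positivity of \<open>q\<close> gives continuity of the power at base 0, so the limit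
  also covers \<open>Lip X f = 0\<close>.\<close>

lemma total_persistence_Lip:
  fixes X :: "'a::metric_space set"
  assumes "tame_bounded F n X f B" "total_persistence_bound F n X q C" "Lipschitz_function X f" "q > 0"
  shows "real_pers q (persistence_diagram F n X f) \<le> C * Lip X f powr q"
proof (rule tendsto_lowerbound)
  show "tendsto (\<lambda>c. C * c powr q) (C * Lip X f powr q) (at_right (Lip X f))"
  proof (intro tendsto_mult tendsto_powr2 tendsto_const tendsto_ident_at)
    show "\<forall>\<^sub>F c in at_right (Lip X f). 0 \<le> c"
      using eventually_at_right_less[of "Lip X f"]
      by eventually_elim (use Lip_nonneg[OF assms(3)] in linarith)
  qed (rule assms(4))
  show "\<forall>\<^sub>F c in at_right (Lip X f). real_pers q (persistence_diagram F n X f) \<le> C * c powr q"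
    using eventually_at_right_less[of "Lip X f"]
    by eventually_elim (rule total_persistence_scaled(2)[OF assms(1-3)])
qed simp

lemma abs_le_sup_norm:
  fixes f :: "'a::topological_space \<Rightarrow> real"
  assumes "compact X" "continuous_on X f" "x \<in> X"
  shows "\<bar>f x\<bar> \<le> sup_norm X f"
proof -
  have "compact ((\<lambda>x. \<bar>f x\<bar>) ` X)"
    using assms(1,2) by (intro compact_continuous_image continuous_intros)
  then have "bdd_above ((\<lambda>x. \<bar>f x\<bar>) ` X)"
    by (intro bounded_imp_bdd_above compact_imp_bounded)
  then have "\<bar>f x\<bar> \<le> (SUP x\<in>X. \<bar>f x\<bar>)" using assms(3) by (rule cSUP_upper[rotated])
  then show ?thesis using assms(3) by (auto simp: sup_norm_def)
qed

lemma sup_norm_nonneg: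
  fixes f :: "'a::topological_space \<Rightarrow> real"
  assumes "compact X" "continuous_on X f"
  shows "0 \<le> sup_norm X f"
proof (cases "X = {}")
  case False
  then show ?thesis using abs_le_sup_norm[OF assms] by fastforce
qed (simp add: sup_norm_def)

lemma Lipschitz_function_continuous: "Lipschitz_function X f \<Longrightarrow> continuous_on X f"
  by (auto simp: Lipschitz_function_def intro: lipschitz_on_continuous_on)

theorem theorem5p5:
  fixes F :: "'k::field itself" and n :: nat
    and X :: "'a::metric_space set" and \<T> :: "'b::euclidean_space set set"
    and f g :: "'a \<Rightarrow> real" and k p C_k C_k1 :: real
  assumes "compact X" and "triangulates \<T> X"
    and "k \<ge> 1" and "bounded_total_persistence F n X k"
    and "total_persistence_bound F n X k C_k"
    and "total_persistence_bound F n X (k + 1) C_k1"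
    and "tame F n X f" and "Lipschitz_function X f"
    and "tame F n X g" and "Lipschitz_function X g"
    and "p \<ge> k"
  shows "ennreal_powr
           (landscape_distance p (persistence_diagram F n X f) (persistence_diagram F n X g)) p
         \<le> ennreal
             ((C_k * sup_norm X f * (Lip X f powr k + Lip X g powr k)
               + C_k1 * (1 / (p + 1)) * (Lip X f powr (k + 1) + Lip X g powr (k + 1)))
              * rpow (sup_norm X (\<lambda>x. f x - g x)) (p - k))"
proof -
  note compact = assms(1) and k = assms(3) and C = assms(5,6) and p = assms(11)
    and f = assms(7,8) and g = assms(9,10)
  define M where "M = sup_norm X f"
  define \<epsilon> where "\<epsilon> = sup_norm X (\<lambda>x. f x - g x)"
  let ?D = "persistence_diagram F n X f" and ?D' = "persistence_diagram F n X g"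
  note cont = Lipschitz_function_continuous[OF f(2)] Lipschitz_function_continuous[OF g(2)]
  have M: "0 \<le> M" "\<And>x. x \<in> X \<Longrightarrow> \<bar>f x\<bar> \<le> M"
    unfolding M_def using sup_norm_nonneg abs_le_sup_norm compact cont(1) by blast+
  have "continuous_on X (\<lambda>x. f x - g x)" using cont by (intro continuous_intros)
  then have \<epsilon>: "0 \<le> \<epsilon>" "\<And>x. x \<in> X \<Longrightarrow> \<bar>f x - g x\<bar> \<le> \<epsilon>"
    unfolding \<epsilon>_def using sup_norm_nonneg abs_le_sup_norm[of X "\<lambda>x. f x - g x"] compact by blast+
  have tf: "tame_bounded F n X f M" using f(1) M(2) by unfold_locales
  have "\<bar>g x\<bar> \<le> M + \<epsilon>" if "x \<in> X" for x using M(2)[OF that] \<epsilon>(2)[OF that] by linarith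
  then have tg: "tame_bounded F n X g (M + \<epsilon>)" using g(1) by unfold_locales
  have points: "\<exists>e. d = ereal e \<and> b \<le> e \<and> (e - b) / 2 - \<epsilon> \<le> M" if "(b, d) \<in># ?D + ?D'" for b d
  proof -
    \<comment> \<open>Any constant above the Lipschitz constant serves here, since only the absence
      of infinite deaths is wanted.\<close>
    have "(b, \<infinity>) \<notin># ?D" "(b, \<infinity>) \<notin># ?D'"
      using total_persistence_scaled(1)[OF tf C(1) f(2), of "Lip X f + 1"]
        total_persistence_scaled(1)[OF tg C(1) g(2), of "Lip X g + 1"] by auto
    then have "d \<noteq> \<infinity>" using that by auto
    have "\<exists>e. d = ereal e \<and> b < e \<and> (e - b) / 2 \<le> M + \<epsilon>"
    proof (cases "(b, d) \<in># ?D")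
      case True
      then show ?thesis using diagram_mem[OF tf True \<open>d \<noteq> \<infinity>\<close>] \<epsilon>(1) by fastforce
    next
      case False
      then have "(b, d) \<in># ?D'" using that by simp
      then show ?thesis using diagram_mem[OF tg _ \<open>d \<noteq> \<infinity>\<close>] by blast
    qed
    then obtain e where "d = ereal e" "b < e" "(e - b) / 2 \<le> M + \<epsilon>" by blast
    then show ?thesis by (intro exI[of _ e]) (simp add: less_imp_le diff_le_eq)
  qed
  have "ennreal_powr (landscape_distance p ?D ?D') p
    = suminf (\<lambda>j. \<integral>\<^sup>+ t. ennreal (\<bar>landscape ?D (Suc j) t - landscape ?D' (Suc j) t\<bar> powr p) \<partial>lborel)"
    unfolding landscape_distance_def using k p by (intro ennreal_powr_inverse) simp
  also have "\<dots> \<le> ennreal ((M * (real_pers k ?D + real_pers k ?D')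
      + (real_pers (k + 1) ?D + real_pers (k + 1) ?D') / (p + 1)) * rpow \<epsilon> (p - k))"
    using landscape_stability[OF tf tg \<epsilon>(2,1)]
    by (intro landscape_distance_bound \<epsilon>(1) k p M(1) points) auto
  also have "\<dots> \<le> ennreal ((C_k * M * (Lip X f powr k + Lip X g powr k)
      + C_k1 * (1 / (p + 1)) * (Lip X f powr (k + 1) + Lip X g powr (k + 1))) * rpow \<epsilon> (p - k))"
  proof (intro ennreal_leI mult_right_mono add_mono)
    have "real_pers k ?D + real_pers k ?D' \<le> C_k * (Lip X f powr k + Lip X g powr k)"
      using total_persistence_Lip[OF tf C(1) f(2)] total_persistence_Lip[OF tg C(1) g(2)] k
      by (simp add: distrib_left)
    from mult_left_mono[OF this M(1)]
    show "M * (real_pers k ?D + real_pers k ?D') \<le> C_k * M * (Lip X f powr k + Lip X g powr k)"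
      by (simp add: mult_ac)
    have "real_pers (k + 1) ?D + real_pers (k + 1) ?D'
      \<le> C_k1 * (Lip X f powr (k + 1) + Lip X g powr (k + 1))"
      using total_persistence_Lip[OF tf C(2) f(2)] total_persistence_Lip[OF tg C(2) g(2)] k
      by (simp add: distrib_left)
    from divide_right_mono[OF this, of "p + 1"]
    show "(real_pers (k + 1) ?D + real_pers (k + 1) ?D') / (p + 1)
      \<le> C_k1 * (1 / (p + 1)) * (Lip X f powr (k + 1) + Lip X g powr (k + 1))"
      using k p by simp
    show "0 \<le> rpow \<epsilon> (p - k)" by (simp add: rpow_def)
  qed
  finally show ?thesis unfolding M_def \<epsilon>_def .
qed

end
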